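(* Let $G$ be a connected graph of order $n$ that contains no induced $5$-cycle and no induced $6$-cycle (that is, no induced subgraph of $G$ is isomorphic to $C_5$ or to $C_6$). If $G$ is not isomorphic to any of $P_3$, $C_3$, $C_7$, $C_{11}$, then $\iota_1(G) \leq \frac{n}{4}$.
   Context: All graphs are finite, simple and undirected (with at least one vertex). The order of a graph $G$ is $|V(G)|$. $P_n$ and $C_n$ denote the path and the cycle on $n$ vertices, respectively. For $D \subseteq V(G)$, $N[D]$ denotes the closed neighborhood of $D$, i.e. the set of vertices that lie in $D$ or are adjacent to a vertex of $D$; $G-N[D]$ is the graph obtained from $G$ by deleting all vertices of $N[D]$. A subset $D \subseteq V(G)$ is a $1$-isolating set of $G$ if $\Delta(G-N[D]) \leq 1$ (where $\Delta$ is the maximum degree), i.e. $G-N[D]$ consists of isolated edges and isolated vertices only (possibly $G-N[D]$ has no vertices). The $1$-isolation number $\iota_1(G)$ is the minimum cardinality of a $1$-isolating set of $G$ (the empty set is allowed as a $1$-isolating set, so e.g. $\iota_1(K_1)=\iota_1(K_2)=0$). *)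

theory Defs
  imports Complex_Main "Graph_Theory.Digraph_Component" "Graph_Theory.Digraph_Isomorphism"
begin

text \<open>
  Finite simple undirected graphs are rendered by the locale predicate \<open>Digraph.graph\<close>: finite
  symmetric digraphs without loops and parallel arcs. An undirected edge \<open>uv\<close> corresponds to the
  two arcs from \<open>u\<close> to \<open>v\<close> and from \<open>v\<close> to \<open>u\<close>.
\<close>

definition path_graph :: "nat \<Rightarrow> (nat, nat \<times> nat) pre_digraph" where
  "path_graph n = with_proj
     \<lparr> pverts = {..<n},
       parcs = {(i, j). i < n \<and> j < n \<and> (j = i + 1 \<or> i = j + 1)} \<rparr>"

text \<open>Only meaningful as an undirected simple graph for \<open>n \<ge> 3\<close>.\<close>

definition cycle_graph :: "nat \<Rightarrow> (nat, nat \<times> nat) pre_digraph" where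
  "cycle_graph n = with_proj
     \<lparr> pverts = {..<n},
       parcs = {(i, j). i < n \<and> j < n \<and> (j = (i + 1) mod n \<or> i = (j + 1) mod n)} \<rparr>"

definition closed_nbhd :: "('a, 'b) pre_digraph \<Rightarrow> 'a set \<Rightarrow> 'a set" where
  "closed_nbhd G D = {v \<in> verts G. v \<in> D \<or> (\<exists>u\<in>D. u \<rightarrow>\<^bsub>G\<^esub> v)}"

definition delete_verts :: "('a, 'b) pre_digraph \<Rightarrow> 'a set \<Rightarrow> ('a, 'b) pre_digraph" where
  "delete_verts G S = G \<restriction> (verts G - S)"

text \<open>
  In a simple graph the degree of a vertex is its out-degree, since each incident edge contributes
  exactly one outgoing arc. The inserted \<open>0\<close> only matters for the null graph, which arises as
  \<open>G - N[D]\<close> when \<open>D\<close> is dominating.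
\<close>

definition max_degree :: "('a, 'b) pre_digraph \<Rightarrow> nat" where
  "max_degree G = Max (insert 0 (out_degree G ` verts G))"

definition one_isolating_set :: "('a, 'b) pre_digraph \<Rightarrow> 'a set \<Rightarrow> bool" where
  "one_isolating_set G D \<longleftrightarrow>
     D \<subseteq> verts G \<and> max_degree (delete_verts G (closed_nbhd G D)) \<le> 1"

definition one_isolation_number :: "('a, 'b) pre_digraph \<Rightarrow> nat" where
  "one_isolation_number G = Min (card ` {D. one_isolating_set G D})"

definition contains_induced :: "('a, 'b) pre_digraph \<Rightarrow> ('c, 'd) pre_digraph \<Rightarrow> bool" where
  "contains_induced G F \<longleftrightarrow> (\<exists>H. induced_subgraph H G \<and> digraph_iso H F)"

end

theory Submission
  imports Defs
begin

text \<open>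
  In a minimal counterexample, select a vertex \<open>v\<close> of degree \<open>d \<ge> 3\<close>. Deleting \<open>N[v]\<close> must leave
  at least \<open>d - 2\<close> components that are exceptional (order 3, \<open>C\<^sub>7\<close> or \<open>C\<^sub>11\<close>), since all other
  components satisfy the bound. An exceptional component becomes cheap as soon as one of its vertices
  is dominated, so no exceptional component hangs on a single cut vertex, and counting the links
  between \<open>N(v)\<close> and the exceptional components leaves only \<open>d \<le> 4\<close>. Repeating the argument with
  other vertices in place of \<open>v\<close>, and using the absence of induced 5- and 6-cycles, first excludes
  degree 4, then exceptional components that are cycles, and finally those of order 3. Graphs of
  maximum degree at most 2 are paths and cycles.
\<close>

text \<open>The constants rest on one coincidence. An exceptional graph of order m has an isolating
  set of (m+1)/4 vertices, a quarter too many, but once any one of its vertices is removed, (m-3)/4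
  vertices suffice. So if a set T is deleted and settled by X, a counterexample satisfies |T| + 4p <
  4|X| + b, where b counts the exceptional components of the rest and p those adjacent to X. A
  neighbour of v shared by two such components would dominate both at the price of one, so they hang
  on disjoint sets of at least two neighbours of v; this gives 2b \<le> d \<le> b + 2. The obstacle
  is that counting alone leaves degrees 3 and 4 open. There the inequality is used in reverse: it
  forces an exceptional component around a new centre, and such a component is very restricted, with
  order 3, 7 or 11 and degrees at most 2. The forbidden cycles mostly enter in one way: two
  neighbours of v joined by a short path through a component close a 5- or 6-cycle, with or without
  v, so some chord must exist.\<close>

locale ugraph =
  fixes E :: "'a \<Rightarrow> 'a \<Rightarrow> bool"
  assumes sym: "E x y \<Longrightarrow> E y x"
    and irrefl [simp]: "\<not> E x x"
begin

text \<open>Closed sets are the unions of components. Phrasing connectivity through them rather than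
  through walks turns components, separation and restriction to subsets into set algebra.\<close>

definition closed_in :: "'a set \<Rightarrow> 'a set \<Rightarrow> bool" where
  "closed_in V A \<longleftrightarrow> A \<subseteq> V \<and> (\<forall>u\<in>A. \<forall>w\<in>V. E u w \<longrightarrow> w \<in> A)"

definition conn :: "'a set \<Rightarrow> bool" where
  "conn V \<longleftrightarrow> V \<noteq> {} \<and> (\<forall>A. closed_in V A \<longrightarrow> A \<noteq> {} \<longrightarrow> A = V)"

definition is_component :: "'a set \<Rightarrow> 'a set \<Rightarrow> bool" where
  "is_component V C \<longleftrightarrow> closed_in V C \<and> conn C"

text \<open>Taken in the whole relation \<open>E\<close> and cut down to a vertex set only where it
  is used, so the same \<open>nbhd D\<close> serves all induced subgraphs.\<close>

definition nbhd :: "'a set \<Rightarrow> 'a set" where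
  "nbhd D = D \<union> {u. \<exists>d\<in>D. E d u}"

text \<open>Maximum degree at most 1 is expressed as uniqueness of the neighbour, which needs no
  cardinalities and passes easily to unions.\<close>

definition isolating :: "'a set \<Rightarrow> 'a set \<Rightarrow> bool" where
  "isolating V D \<longleftrightarrow> D \<subseteq> V \<and>
     (\<forall>u\<in>V - nbhd D. \<forall>y\<in>V - nbhd D. \<forall>z\<in>V - nbhd D. E u y \<longrightarrow> E u z \<longrightarrow> y = z)"

definition path_enum :: "(nat \<Rightarrow> 'a) \<Rightarrow> nat \<Rightarrow> 'a set \<Rightarrow> bool" where
  "path_enum h n H \<longleftrightarrow> bij_betw h {..<n} H \<and>
     (\<forall>i<n. \<forall>j<n. E (h i) (h j) \<longleftrightarrow> j = i + 1 \<or> i = j + 1)"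

definition cycle_enum :: "(nat \<Rightarrow> 'a) \<Rightarrow> nat \<Rightarrow> 'a set \<Rightarrow> bool" where
  "cycle_enum h n H \<longleftrightarrow> 3 \<le> n \<and> bij_betw h {..<n} H \<and>
     (\<forall>i<n. \<forall>j<n. E (h i) (h j) \<longleftrightarrow> j = (i + 1) mod n \<or> i = (j + 1) mod n)"

text \<open>For a connected \<open>H\<close>, order 3 stands for P3 and C3 at once.\<close>

definition bad :: "'a set \<Rightarrow> bool" where
  "bad H \<longleftrightarrow> card H = 3 \<or> (\<exists>k h. (k = 7 \<or> k = 11) \<and> cycle_enum h k H)"

definition good :: "'a set \<Rightarrow> bool" where
  "good V \<longleftrightarrow> (\<exists>D. isolating V D \<and> 4 * card D \<le> card V)"

lemma sym_iff: "E x y \<longleftrightarrow> E y x"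
  using sym by blast

subsection \<open>Components\<close>

text \<open>The component of \<open>x\<close> is the least closed set around \<open>x\<close>. If
  \<open>A\<close> is closed in it, both \<open>A\<close> and \<open>C - A\<close> are closed in
  \<open>V\<close>, and the one containing \<open>x\<close> must be all of \<open>C\<close>.\<close>

lemma ex_component:
  assumes "x \<in> V"
  shows "\<exists>C. is_component V C \<and> x \<in> C"
proof -
  define C where "C = \<Inter>{A. closed_in V A \<and> x \<in> A}"
  have V: "closed_in V V" by (auto simp: closed_in_def)
  have x: "x \<in> C" by (auto simp: C_def)
  have cl: "closed_in V C"
    using V assms unfolding C_def closed_in_def by blast
  have "A = C" if A: "closed_in C A" "A \<noteq> {}" for A
  proof (cases "x \<in> A")
    case True
    have "closed_in V A" using A cl unfolding closed_in_def by blast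
    then have "C \<subseteq> A" using True unfolding C_def by blast
    then show ?thesis using A unfolding closed_in_def by blast
  next
    case False
    have "closed_in V (C - A)" using A cl sym unfolding closed_in_def by blast
    then have "C \<subseteq> C - A" using False x unfolding C_def by blast
    then show ?thesis using A unfolding closed_in_def by blast
  qed
  then have "conn C" using x unfolding conn_def by blast
  then show ?thesis using cl x unfolding is_component_def by blast
qed

text \<open>The standard way below to place a connected set inside a component: it suffices that the
  two meet.\<close>

lemma conn_subset_closed:
  assumes "conn C" "C \<subseteq> V" "closed_in V A" "C \<inter> A \<noteq> {}"
  shows "C \<subseteq> A"
proof -
  have "closed_in C (C \<inter> A)" using assms unfolding closed_in_def by blast
  then show ?thesis using assms unfolding conn_def by blast
qed

lemma component_unique:
  assumes "is_component V C" "is_component V C'" "C \<inter> C' \<noteq> {}"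
  shows "C = C'"
proof
  show "C \<subseteq> C'"
    using conn_subset_closed[of C V C'] assms unfolding is_component_def closed_in_def by blast
  show "C' \<subseteq> C"
    using conn_subset_closed[of C' V C] assms unfolding is_component_def closed_in_def by blast
qed

lemma conn_walk:
  assumes "a \<le> (b::nat)" and "\<And>i. a \<le> i \<Longrightarrow> i < b \<Longrightarrow> E (h i) (h (Suc i))"
  shows "conn (h ` {a..b})"
  unfolding conn_def
proof (intro conjI allI impI)
  show "h ` {a..b} \<noteq> {}" using assms(1) by auto
  fix A assume A: "closed_in (h ` {a..b}) A" "A \<noteq> {}"
  obtain i where i: "a \<le> i" "i \<le> b" "h i \<in> A" using A unfolding closed_in_def by fastforce
  have up: "h j \<in> A" if "i \<le> j" "j \<le> b" for j
    using that
  proof (induction j rule: dec_induct)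
    case base then show ?case using i by simp
  next
    case (step m)
    then have "E (h m) (h (Suc m))" "h m \<in> A" using assms(2)[of m] i by auto
    then show ?case using A step i unfolding closed_in_def by auto
  qed
  have down: "h j \<in> A" if "j \<le> i" "a \<le> j" for j
    using that
  proof (induction j rule: inc_induct)
    case base then show ?case using i by simp
  next
    case (step m)
    then have "E (h (Suc m)) (h m)" "h (Suc m) \<in> A" using assms(2)[of m] i sym by auto
    then show ?case using A step i unfolding closed_in_def by auto
  qed
  have "h j \<in> A" if "a \<le> j" "j \<le> b" for j
    using up[of j] down[of j] that by linarith
  then have "h ` {a..b} \<subseteq> A" by auto
  then show "A = h ` {a..b}" using A unfolding closed_in_def by blast
qed

lemma conn_three_adj:
  assumes "conn H" "card H = 3" "a \<in> H" "b \<in> H" "a \<noteq> b" "\<not> E a b"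
  obtains c where "c \<in> H" "c \<noteq> a" "c \<noteq> b" "E a c" "E c b" "H = {a, b, c}"
proof -
  have fin: "finite H" using assms(2) card.infinite by fastforce
  have "card (H - {a, b}) = 1" using assms fin by (simp add: card_Diff_subset)
  then obtain c where c: "H - {a, b} = {c}" by (meson card_1_singletonE)
  have H: "H = {a, b, c}" using c assms by blast
  have ca: "c \<noteq> a" "c \<noteq> b" using c by blast+
  have "E a c"
  proof (rule ccontr)
    assume "\<not> E a c"
    then have "closed_in H {a}" using H assms unfolding closed_in_def by auto
    then show False using assms unfolding conn_def by blast
  qed
  moreover have "E b c"
  proof (rule ccontr)
    assume "\<not> E b c"
    then have "closed_in H {b}" using H assms sym unfolding closed_in_def by auto
    then show False using assms unfolding conn_def by blast
  qed
  ultimately show thesis using that H ca sym by blast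
qed

subsection \<open>Isolating sets of paths and cycles\<close>

text \<open>Positions 3, 8, 13, ... are chosen. Each dominates three vertices, and the two left over
  between consecutive blocks may stay as an isolated edge. The bound is the ceiling of (n -
  2)/5.\<close>

lemma path_isolating:
  assumes "path_enum h n H"
  shows "\<exists>D. isolating H D \<and> card D \<le> (n + 2) div 5"
proof -
  have bij: "bij_betw h {..<n} H"
    and adj: "\<And>i j. i < n \<Longrightarrow> j < n \<Longrightarrow> E (h i) (h j) \<longleftrightarrow> j = i + 1 \<or> i = j + 1"
    using assms unfolding path_enum_def by auto
  define f where "f t = min (5 * t + 3) (n - 1)" for t :: nat
  define I where "I = f ` {..<(n + 2) div 5}"
  define D where "D = h ` I"
  have IN: "i < n" if "i \<in> I" for i
    using that unfolding I_def f_def by (cases "n = 0") auto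
  \<comment> \<open>Positions \<open>i\<close>, \<open>i + 1\<close>, \<open>i + 2\<close> stay
    undominated only if nothing from \<open>i - 1\<close> to \<open>i + 3\<close> is chosen, but the
    multiple of 5 just below or at \<open>i\<close>, plus 3, always lies there, capped or
    not.\<close>
  have mid: False if ij: "i + 2 < n" and un: "\<And>d. d \<in> I \<Longrightarrow> d + 1 < i \<or> i + 3 < d" for i
  proof -
    define t where "t = i div 5"
    have t: "t < (n + 2) div 5" unfolding t_def using ij by linarith
    then have "f t \<in> I" unfolding I_def by blast
    from un[OF this] show False unfolding f_def t_def using ij by linarith
  qed
  have dom: "d + 1 < i \<or> i + 1 < d" if "h i \<in> H - nbhd D" "i < n" "d \<in> I" for i d
  proof (rule ccontr)
    assume "\<not> ?thesis"
    then have "d = i \<or> i = d + 1 \<or> d = i + 1" by linarith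
    then have "h i = h d \<or> E (h d) (h i)" using adj that IN by blast
    then show False using that unfolding nbhd_def D_def by blast
  qed
  have "y = z" if "u \<in> H - nbhd D" "y \<in> H - nbhd D" "z \<in> H - nbhd D" "E u y" "E u z" for u y z
  proof -
    have "u \<in> h ` {..<n}" "y \<in> h ` {..<n}" "z \<in> h ` {..<n}"
      using that bij unfolding bij_betw_def by blast+
    then obtain i j l where ijl: "i < n" "j < n" "l < n" "u = h i" "y = h j" "z = h l"
      by blast
    have "j = i + 1 \<or> i = j + 1" "l = i + 1 \<or> i = l + 1" using adj ijl that by blast+
    moreover have False if w: "w + 2 < n" "h w \<in> H - nbhd D" "h (w + 1) \<in> H - nbhd D"
      "h (w + 2) \<in> H - nbhd D" for w
    proof (rule mid[OF w(1)])
      fix d assume d: "d \<in> I"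
      show "d + 1 < w \<or> w + 3 < d"
        using dom[OF w(2) _ d] dom[OF w(3) _ d] dom[OF w(4) _ d] w(1) by linarith
    qed
    then have "\<not> (j = i + 1 \<and> i = l + 1)" "\<not> (l = i + 1 \<and> i = j + 1)"
      using ijl that(1-3) by (auto simp: numeral_2_eq_2)
    ultimately have "j = l" by linarith
    then show ?thesis using ijl by simp
  qed
  moreover have "D \<subseteq> H" using IN bij unfolding D_def bij_betw_def by blast
  ultimately have "isolating H D" unfolding isolating_def by blast
  moreover have "card D \<le> (n + 2) div 5"
    unfolding D_def I_def image_image using card_image_le[of "{..<(n + 2) div 5}"] by simp
  ultimately show ?thesis by blast
qed

text \<open>The pattern is that of paths, but windows of three also wrap around the end, so the
  bound rises to the ceiling of n/5.\<close>

lemma cycle_isolating: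
  assumes "cycle_enum h n H"
  shows "\<exists>D. isolating H D \<and> card D \<le> (n + 4) div 5"
proof -
  have n3: "3 \<le> n" and bij: "bij_betw h {..<n} H"
    and adj: "\<And>i j. i < n \<Longrightarrow> j < n \<Longrightarrow> E (h i) (h j) \<longleftrightarrow> j = (i + 1) mod n \<or> i = (j + 1) mod n"
    using assms unfolding cycle_enum_def by auto
  have nx: "(i + 1) mod n = (if i = n - 1 then 0 else i + 1)" if "i < n" for i
    using that n3 by auto
  define f where "f t = min (5 * t + 3) (n - 1)" for t :: nat
  define I where "I = f ` {..<(n + 4) div 5}"
  define D where "D = h ` I"
  have IN: "i < n" if "i \<in> I" for i
    using that n3 unfolding I_def f_def by auto
  have mid: "\<exists>d\<in>I. i \<le> d + 1 \<and> d \<le> i + 3" if ij: "i + 2 < n" for i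
  proof -
    define t where "t = i div 5"
    have t: "t < (n + 4) div 5" unfolding t_def using ij by linarith
    then have "f t \<in> I" unfolding I_def by blast
    moreover have "i \<le> f t + 1" "f t \<le> i + 3" unfolding f_def t_def using ij by linarith+
    ultimately show ?thesis by blast
  qed
  \<comment> \<open>The last chosen position is one of the two final ones, which hits the two
    windows that wrap around, starting at \<open>n - 2\<close> and at \<open>n - 1\<close>.\<close>
  have fin: "n - 1 \<in> I \<or> n - 2 \<in> I"
  proof -
    define t where "t = (n + 4) div 5 - 1"
    have t: "t < (n + 4) div 5" unfolding t_def using n3 by linarith
    then have "f t \<in> I" unfolding I_def by blast
    moreover have "f t = n - 1 \<or> f t = n - 2" unfolding f_def t_def using n3 by linarith
    ultimately show ?thesis by metis
  qed
  define U where "U i \<longleftrightarrow> i < n \<and> i \<notin> I \<and> (\<forall>d\<in>I. i \<noteq> (d + 1) mod n \<and> d \<noteq> (i + 1) mod n)" for i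
  have U: "U i" if "h i \<in> H - nbhd D" "i < n" for i
    unfolding U_def
  proof (intro conjI ballI notI)
    show "i < n" by fact
    show False if "i \<in> I" using that \<open>h i \<in> H - nbhd D\<close> unfolding nbhd_def D_def by blast
    fix d assume d: "d \<in> I"
    have "\<not> E (h d) (h i)" using d \<open>h i \<in> H - nbhd D\<close> unfolding nbhd_def D_def by blast
    then have "\<not> (i = (d + 1) mod n \<or> d = (i + 1) mod n)" using adj[OF IN[OF d] \<open>i < n\<close>] by blast
    then show False if "i = (d + 1) mod n" using that by blast
    show False if "d = (i + 1) mod n"
      using that \<open>\<not> (i = (d + 1) mod n \<or> d = (i + 1) mod n)\<close> by blast
  qed
  have win: "\<not> (U i \<and> U ((i + 1) mod n) \<and> U ((i + 2) mod n))" if i: "i < n" for i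
  proof (cases "i + 2 < n")
    case True
    then obtain d where d: "d \<in> I" "i \<le> d + 1" "d \<le> i + 3" using mid by blast
    have "d < n" using d IN by blast
    have "U i \<Longrightarrow> d \<noteq> i" "U (i + 1) \<Longrightarrow> d \<noteq> i + 1" "U (i + 2) \<Longrightarrow> d \<noteq> i + 2"
      using d unfolding U_def by blast+
    moreover have "d + 1 \<noteq> i" if "U i"
      using that d True unfolding U_def by (metis add_lessD1 mod_less)
    moreover have "d \<noteq> i + 3" if "U (i + 2)"
    proof
      assume "d = i + 3"
      then have "d = (i + 2 + 1) mod n" using \<open>d < n\<close> by simp
      then show False using that d unfolding U_def by blast
    qed
    moreover have "(i + 1) mod n = i + 1" "(i + 2) mod n = i + 2" using True by simp_all
    moreover have "d + 1 = i \<or> d = i \<or> d = i + 1 \<or> d = i + 2 \<or> d = i + 3" using d by linarith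
    ultimately show ?thesis by fastforce
  next
    case False
    then consider "i + 2 = n" | "i + 1 = n" using i by linarith
    then show ?thesis
    proof cases
      case 1
      then have "i = n - 2" "(i + 1) mod n = n - 1" using n3 by auto
      then show ?thesis using fin unfolding U_def by metis
    next
      case 2
      then have i: "i = n - 1" "(i + 1) mod n = 0" "(n - 2 + 1) mod n = n - 1" using n3 by auto
      show ?thesis using fin i unfolding U_def by metis
    qed
  qed
  have "y = z" if "u \<in> H - nbhd D" "y \<in> H - nbhd D" "z \<in> H - nbhd D" "E u y" "E u z" for u y z
  proof -
    have "u \<in> h ` {..<n}" "y \<in> h ` {..<n}" "z \<in> h ` {..<n}"
      using that bij unfolding bij_betw_def by blast+
    then obtain i j l where ijl: "i < n" "j < n" "l < n" "u = h i" "y = h j" "z = h l"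
      by blast
    have U3: "U i" "U j" "U l" using U ijl that by blast+
    have "j = (i + 1) mod n \<or> i = (j + 1) mod n" "l = (i + 1) mod n \<or> i = (l + 1) mod n"
      using adj ijl that by blast+
    moreover have "\<not> (j = (i + 1) mod n \<and> i = (l + 1) mod n)"
      using win[of l] U3 ijl by (metis (no_types, lifting) add.assoc mod_add_left_eq one_add_one)
    moreover have "\<not> (l = (i + 1) mod n \<and> i = (j + 1) mod n)"
      using win[of j] U3 ijl by (metis (no_types, lifting) add.assoc mod_add_left_eq one_add_one)
    ultimately have "j = (i + 1) mod n \<and> l = (i + 1) mod n \<or> i = (j + 1) mod n \<and> i = (l + 1) mod n"
      by blast
    then have "j = l" using nx[of j] nx[of l] ijl by (auto split: if_splits)
    then show ?thesis using ijl by simp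
  qed
  moreover have "D \<subseteq> H" using IN bij unfolding D_def bij_betw_def by blast
  ultimately have "isolating H D" unfolding isolating_def by blast
  moreover have "card D \<le> (n + 4) div 5"
    unfolding D_def I_def image_image using card_image_le[of "{..<(n + 4) div 5}"] by simp
  ultimately show ?thesis by blast
qed

text \<open>Take a longest path. Its ends have no neighbour off the path by maximality, and its
  inner vertices already have two neighbours on it, so its vertex set is closed and equals
  \<open>V\<close>. The only chord that the degree bound permits joins the two ends.\<close>

lemma deg2_enum:
  assumes fin: "finite V" and con: "conn V" and deg: "\<And>u. u \<in> V \<Longrightarrow> card {w\<in>V. E u w} \<le> 2"
  shows "(\<exists>h. path_enum h (card V) V) \<or> (\<exists>h. cycle_enum h (card V) V)"
proof -
  define W where "W n h \<longleftrightarrow> inj_on h {..<n} \<and> h ` {..<n} \<subseteq> V \<and> (\<forall>i. Suc i < n \<longrightarrow> E (h i) (h (Suc i)))"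
    for n and h :: "nat \<Rightarrow> 'a"
  define P where "P n \<longleftrightarrow> (\<exists>h. W n h)" for n
  have bound: "n \<le> card V" if "P n" for n
    using that card_inj_on_le[of _ "{..<n}" V] fin unfolding P_def W_def by auto
  obtain x where x: "x \<in> V" using con unfolding conn_def by blast
  have "P 1" unfolding P_def W_def using x by (intro exI[of _ "\<lambda>_. x"]) (auto simp: inj_on_def)
  define n where "n = Greatest P"
  have "P n" unfolding n_def using GreatestI_nat[of P 1 "card V"] \<open>P 1\<close> bound by blast
  have n1: "1 \<le> n" unfolding n_def using Greatest_le_nat[of P 1 "card V"] \<open>P 1\<close> bound by blast
  have nmax: "\<not> P (Suc n)" using Greatest_le_nat[of P "Suc n" "card V"] bound unfolding n_def[symmetric]
    by (metis not_less_eq_eq order_refl)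
  obtain h where h: "W n h" using \<open>P n\<close> P_def by blast
  have inj: "inj_on h {..<n}" and sub: "\<And>i. i < n \<Longrightarrow> h i \<in> V"
    and step: "\<And>i. Suc i < n \<Longrightarrow> E (h i) (h (Suc i))"
    using h unfolding W_def by auto
  have injD: "h i = h j \<longleftrightarrow> i = j" if "i < n" "j < n" for i j
    using inj that by (auto dest: inj_onD)
  have three: False if "u \<in> V" "a \<in> V" "b \<in> V" "c \<in> V" "E u a" "E u b" "E u c" "distinct [a, b, c]"
    for u a b c
  proof -
    have "card {a, b, c} \<le> card {w\<in>V. E u w}" using that fin by (intro card_mono) auto
    then show False using deg[of u] that by auto
  qed
  have last: "\<not> E (h (n - 1)) w" if "w \<in> V" "w \<notin> h ` {..<n}" for w
  proof
    assume "E (h (n - 1)) w"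
    then have "W (Suc n) (h(n := w))"
      unfolding W_def using that inj sub step n1
      by (auto simp: inj_on_def lessThan_Suc less_Suc_eq)
    then show False using nmax P_def by blast
  qed
  have first: "\<not> E (h 0) w" if "w \<in> V" "w \<notin> h ` {..<n}" for w
  proof
    assume E: "E (h 0) w"
    define g where "g i = (case i of 0 \<Rightarrow> w | Suc j \<Rightarrow> h j)" for i
    have "W (Suc n) g"
      unfolding W_def
    proof (intro conjI allI impI)
      show "inj_on g {..<Suc n}"
      proof (rule inj_onI)
        fix i j assume "i \<in> {..<Suc n}" "j \<in> {..<Suc n}" "g i = g j"
        then show "i = j" using that injD unfolding g_def by (auto split: nat.splits)
      qed
      show "g ` {..<Suc n} \<subseteq> V" using that sub unfolding g_def by (auto split: nat.splits)
      fix i assume "Suc i < Suc n"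
      then show "E (g i) (g (Suc i))"
        using E sym step unfolding g_def by (cases i) auto
    qed
    then show False using nmax P_def by blast
  qed
  have "closed_in V (h ` {..<n})"
    unfolding closed_in_def
  proof (intro conjI ballI impI)
    show "h ` {..<n} \<subseteq> V" using sub by blast
    fix u w assume u: "u \<in> h ` {..<n}" and w: "w \<in> V" "E u w"
    show "w \<in> h ` {..<n}"
    proof (rule ccontr)
      assume nw: "w \<notin> h ` {..<n}"
      obtain i where i: "i < n" "u = h i" using u by blast
      have "i \<noteq> 0" "i \<noteq> n - 1" using first[OF w(1) nw] last[OF w(1) nw] w(2) i(2) by metis+
      then have ii: "0 < i" "Suc i < n" using i by linarith+
      have "E u (h (i - 1))" "E u (h (Suc i))" using step[of "i - 1"] step[of i] sym ii i by auto
      moreover have "distinct [h (i - 1), h (Suc i), w]" using injD[of "i - 1" "Suc i"] ii i nw by auto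
      ultimately show False using three[of u "h (i - 1)" "h (Suc i)" w] w i sub ii by auto
    qed
  qed
  then have HV: "h ` {..<n} = V" using con n1 unfolding conn_def by (metis image_is_empty lessThan_empty_iff not_one_le_zero)
  have cn: "card V = n" using HV inj by (metis card_image card_lessThan)
  have bij: "bij_betw h {..<n} V" using inj HV unfolding bij_betw_def by blast
  have far: "i = 0 \<and> j = n - 1" if ij: "j < n" "i + 2 \<le> j" "E (h i) (h j)" for i j
  proof (rule ccontr)
    assume "\<not> ?thesis"
    then consider "0 < i" | "Suc j < n" using ij by linarith
    then show False
    proof cases
      case 1
      have "E (h i) (h (i - 1))" "E (h i) (h (Suc i))" using step[of "i - 1"] step[of i] sym 1 ij by auto
      moreover have "distinct [h (i - 1), h (Suc i), h j]" using ij 1 by (auto simp: injD)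
      ultimately show False using three[of "h i" "h (i - 1)" "h (Suc i)" "h j"] ij 1 sub by simp
    next
      case 2
      have "E (h j) (h (j - 1))" "E (h j) (h (Suc j))" using step[of "j - 1"] step[of j] sym 2 ij by auto
      moreover have "distinct [h (j - 1), h (Suc j), h i]" using ij 2 by (auto simp: injD)
      ultimately show False using three[of "h j" "h (j - 1)" "h (Suc j)" "h i"] ij 2 sub sym[OF ij(3)] by simp
    qed
  qed
  show ?thesis
  proof (cases "3 \<le> n \<and> E (h 0) (h (n - 1))")
    case True
    have "E (h i) (h j) \<longleftrightarrow> j = (i + 1) mod n \<or> i = (j + 1) mod n" if ij: "i \<le> j" "j < n" for i j
    proof -
      have m: "(i + 1) mod n = (if i = n - 1 then 0 else i + 1)"
        "(j + 1) mod n = (if j = n - 1 then 0 else j + 1)" using that True by auto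
      consider "j = i" | "j = i + 1" | "i + 2 \<le> j" using ij by linarith
      then show ?thesis
      proof cases
        case 1 then show ?thesis using m True by auto
      next
        case 2
        then have "Suc i < n" "i \<noteq> n - 1" "j = Suc i" using ij by linarith+
        then have "E (h i) (h j)" "(i + 1) mod n = j" using step[of i] m(1) by simp_all
        then show ?thesis by blast
      next
        case 3
        have "E (h i) (h j) \<longleftrightarrow> i = 0 \<and> j = n - 1" using far[of j i] ij(2) 3 True by blast
        then show ?thesis unfolding m using 3 ij by auto
      qed
    qed
    then have "E (h i) (h j) \<longleftrightarrow> j = (i + 1) mod n \<or> i = (j + 1) mod n" if "i < n" "j < n" for i j
      using that sym_iff by (metis nat_le_linear)
    then show ?thesis using True bij cn unfolding cycle_enum_def by blast
  next
    case False
    have "E (h i) (h j) \<longleftrightarrow> j = i + 1" if ij: "i \<le> j" "j < n" for i j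
    proof -
      consider "j = i" | "j = i + 1" | "i + 2 \<le> j" using ij by linarith
      then show ?thesis
        using step[of i] far[of j i] ij False by cases auto
    qed
    then have "E (h i) (h j) \<longleftrightarrow> j = i + 1 \<or> i = j + 1" if "i < n" "j < n" for i j
      using that sym_iff by (metis nat_le_linear less_add_one not_less)
    then show ?thesis using bij cn unfolding path_enum_def by blast
  qed
qed

subsection \<open>Enumerations of cycles\<close>

lemma cycle_enum_card: "cycle_enum h k H \<Longrightarrow> card H = k"
  unfolding cycle_enum_def by (metis bij_betw_same_card card_lessThan)

text \<open>A rotation, or a rotation with a reflection, moves any directed edge to positions 0 and
  1. This replaces later without-loss-of-generality choices on cycles.\<close>

lemma cycle_enum_start:
  assumes cyc: "cycle_enum h k H" and uw: "u \<in> H" "w \<in> H" "E u w"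
  obtains g where "cycle_enum g k H" "g 0 = u" "g 1 = w"
proof -
  have k3: "3 \<le> k" and bij: "bij_betw h {..<k} H"
    and adj: "\<And>i j. i < k \<Longrightarrow> j < k \<Longrightarrow> E (h i) (h j) \<longleftrightarrow> j = (i + 1) mod k \<or> i = (j + 1) mod k"
    using cyc unfolding cycle_enum_def by auto
  obtain a b where ab: "a < k" "b < k" "u = h a" "w = h b"
    using uw bij unfolding bij_betw_def by blast
  have mod1: "(i + 1) mod k = (if i + 1 = k then 0 else i + 1)" if "i < k" for i
    using that by auto
  \<comment> \<open>Reindexing preserves the cycle if it commutes with the cyclic successor or turns
    the successor into the predecessor.\<close>
  have re: "cycle_enum (h \<circ> f) k H"
    if f: "bij_betw f {..<k} {..<k}"
      "(\<forall>i<k. f ((i + 1) mod k) = (f i + 1) mod k) \<or> (\<forall>i<k. (f ((i + 1) mod k) + 1) mod k = f i)" for f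
    unfolding cycle_enum_def
  proof (intro conjI allI impI)
    show "3 \<le> k" by fact
    show "bij_betw (h \<circ> f) {..<k} H" using bij_betw_trans f bij by blast
    fix i j assume ij: "i < k" "j < k"
    have fl: "f i < k" "f j < k" using f ij unfolding bij_betw_def by auto
    have inj: "f x = f y \<longleftrightarrow> x = y" if "x < k" "y < k" for x y
      using f that unfolding bij_betw_def inj_on_def by auto
    have inj1: "(x + 1) mod k = (y + 1) mod k \<longleftrightarrow> x = y" if "x < k" "y < k" for x y
      using that mod1 by auto
    have lt: "(i + 1) mod k < k" "(j + 1) mod k < k" using k3 by auto
    have "E ((h \<circ> f) i) ((h \<circ> f) j) \<longleftrightarrow> f j = (f i + 1) mod k \<or> f i = (f j + 1) mod k"
      using adj[OF fl] by simp
    also have "\<dots> \<longleftrightarrow> j = (i + 1) mod k \<or> i = (j + 1) mod k"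
      using f(2)
    proof
      assume "\<forall>i<k. f ((i + 1) mod k) = (f i + 1) mod k"
      then show ?thesis using ij inj lt by metis
    next
      assume r: "\<forall>i<k. (f ((i + 1) mod k) + 1) mod k = f i"
      have "f lt < k" if "lt < k" for lt using f that unfolding bij_betw_def by auto
      then have "f j = (f i + 1) mod k \<longleftrightarrow> i = (j + 1) mod k" "f i = (f j + 1) mod k \<longleftrightarrow> j = (i + 1) mod k"
        using r ij inj inj1 lt by metis+
      then show ?thesis by blast
    qed
    finally show "E ((h \<circ> f) i) ((h \<circ> f) j) \<longleftrightarrow> j = (i + 1) mod k \<or> i = (j + 1) mod k" .
  qed
  have bijI: "bij_betw f {..<k} {..<k}" if "inj_on f {..<k}" "\<And>i. f i < k" for f
    using that endo_inj_surj[of "{..<k}" f] by (auto simp: bij_betw_def)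
  consider "b = (a + 1) mod k" | "a = (b + 1) mod k" using adj ab uw by blast
  then show thesis
  proof cases
    case 1
    define f where "f i = (if a + i < k then a + i else a + i - k)" for i
    \<comment> \<open>The value 0 beyond \<open>k\<close> keeps all values below \<open>k\<close>,
      as \<open>bijI\<close> demands.\<close>
    define f' where "f' i = (if i < k then f i else 0)" for i
    have "bij_betw f' {..<k} {..<k}"
      by (rule bijI) (use ab in \<open>auto simp: inj_on_def f_def f'_def split: if_splits\<close>)
    moreover have "\<forall>i<k. f' ((i + 1) mod k) = (f' i + 1) mod k"
      using ab mod1 by (auto simp: f_def f'_def)
    ultimately have "cycle_enum (h \<circ> f') k H" using re by blast
    moreover have "f' 0 = a" "f' 1 = b" using 1 mod1[of a] ab k3 by (auto simp: f_def f'_def)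
    ultimately show thesis using that ab by auto
  next
    case 2
    define f where "f i = (if i \<le> a then a - i else a + k - i)" for i
    define f' where "f' i = (if i < k then f i else 0)" for i
    have "bij_betw f' {..<k} {..<k}"
      by (rule bijI) (use ab in \<open>auto simp: inj_on_def f_def f'_def split: if_splits\<close>)
    moreover have "\<forall>i<k. (f' ((i + 1) mod k) + 1) mod k = f' i"
      using ab mod1 by (auto simp: f_def f'_def)
    ultimately have "cycle_enum (h \<circ> f') k H" using re by blast
    moreover have "f' 0 = a" "f' 1 = b" using 2 mod1[of b] ab k3 by (auto simp: f_def f'_def split: if_splits)
    ultimately show thesis using that ab by auto
  qed
qed

text \<open>The predecessor is written \<open>(i + k - 1) mod k\<close> because \<open>i - 1\<close>
  is truncated at \<open>i = 0\<close>.\<close>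

lemma cycle_enum_nbrs:
  assumes cyc: "cycle_enum h k H" and i: "i < k"
  shows "{w\<in>H. E (h i) w} = {h ((i + 1) mod k), h ((i + k - 1) mod k)}"
    and "h ((i + 1) mod k) \<noteq> h ((i + k - 1) mod k)"
proof -
  have k3: "3 \<le> k" and bij: "bij_betw h {..<k} H"
    and adj: "\<And>i j. i < k \<Longrightarrow> j < k \<Longrightarrow> E (h i) (h j) \<longleftrightarrow> j = (i + 1) mod k \<or> i = (j + 1) mod k"
    using cyc unfolding cycle_enum_def by auto
  have pred: "i = (j + 1) mod k \<longleftrightarrow> j = (i + k - 1) mod k" if "j < k" for j
  proof (cases "i = 0")
    case True then show ?thesis using that k3 by (auto simp: mod_Suc)
  next
    case False
    then have "i + k - 1 = (i - 1) + k" by simp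
    then have "(i + k - 1) mod k = i - 1" using i by (metis less_imp_diff_less mod_add_self2 mod_less)
    then show ?thesis using that i False by (auto simp: mod_Suc split: if_splits)
  qed
  have H: "H = h ` {..<k}" using bij unfolding bij_betw_def by blast
  have lt: "(i + 1) mod k < k" "(i + k - 1) mod k < k" using k3 by auto
  show "{w\<in>H. E (h i) w} = {h ((i + 1) mod k), h ((i + k - 1) mod k)}"
    using adj[OF i] pred lt unfolding H by auto
  have "(i + 1) mod k \<noteq> (i + k - 1) mod k"
    using pred[of "(i + 1) mod k"] lt i k3 by (auto simp: mod_Suc split: if_splits)
  then show "h ((i + 1) mod k) \<noteq> h ((i + k - 1) mod k)"
    using bij lt unfolding bij_betw_def by (auto dest: inj_onD)
qed

lemma cycle_enum_two_nbrs:
  assumes "cycle_enum h k H" "u \<in> H"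
  obtains p q where "p \<noteq> q" "p \<in> H" "q \<in> H" "{w\<in>H. E u w} = {p, q}"
proof -
  obtain i where i: "i < k" "u = h i" using assms unfolding cycle_enum_def bij_betw_def by blast
  note nb = cycle_enum_nbrs[OF assms(1) i(1), folded i(2)]
  have "h ((i + 1) mod k) \<in> {w\<in>H. E u w}" "h ((i + k - 1) mod k) \<in> {w\<in>H. E u w}"
    unfolding nb(1) by simp_all
  then show thesis using that[OF nb(2) _ _ nb(1)] by blast
qed

lemma cycle_enum_rotate:
  assumes "cycle_enum h k H" "u \<in> H"
  obtains g where "cycle_enum g k H" "g 0 = u"
proof -
  obtain p q where pq: "p \<in> H" "{w\<in>H. E u w} = {p, q}" using cycle_enum_two_nbrs[OF assms] .
  then have "E u p" by blast
  then show thesis using cycle_enum_start[OF assms pq(1)] that by metis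
qed

subsection \<open>Assembling isolating sets\<close>

lemma isolating_insert:
  assumes "isolating (V - {y}) D" "y \<in> V"
  shows "isolating V (insert y D)"
proof -
  have "nbhd D \<subseteq> nbhd (insert y D)" "y \<in> nbhd (insert y D)" unfolding nbhd_def by auto
  then show ?thesis using assms unfolding isolating_def by blast
qed

text \<open>Pieces without edges between them do not interact: the neighbours of a vertex all lie in
  its own piece.\<close>

lemma isolating_family:
  assumes iso: "\<And>i. i \<in> I \<Longrightarrow> isolating (P i) (D i)"
    and sep: "\<And>i j u w. i \<in> I \<Longrightarrow> j \<in> I \<Longrightarrow> u \<in> P i \<Longrightarrow> w \<in> P j \<Longrightarrow> E u w \<Longrightarrow> i = j"
  shows "isolating (\<Union>(P ` I)) (\<Union>(D ` I))"
  unfolding isolating_def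
proof (intro conjI ballI impI)
  show "\<Union>(D ` I) \<subseteq> \<Union>(P ` I)" using iso unfolding isolating_def by blast
  have out: "w \<in> P i - nbhd (D i)" if "w \<in> P i" "i \<in> I" "w \<notin> nbhd (\<Union>(D ` I))" for i w
    using that unfolding nbhd_def by blast
  fix u y z
  assume a: "u \<in> \<Union>(P ` I) - nbhd (\<Union>(D ` I))" "y \<in> \<Union>(P ` I) - nbhd (\<Union>(D ` I))"
    "z \<in> \<Union>(P ` I) - nbhd (\<Union>(D ` I))" "E u y" "E u z"
  then obtain i j l where "i \<in> I" "u \<in> P i" "j \<in> I" "y \<in> P j" "l \<in> I" "z \<in> P l" by blast
  moreover from this have "i = j" "i = l" using sep a by blast+
  ultimately have "i \<in> I" "u \<in> P i - nbhd (D i)" "y \<in> P i - nbhd (D i)" "z \<in> P i - nbhd (D i)"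
    using out a by auto
  then show "y = z" using iso a(4,5) unfolding isolating_def by blast
qed

section \<open>Exceptional graphs and the discharging inequality\<close>

lemma bad_card: "bad H \<Longrightarrow> card H = 3 \<or> card H = 7 \<or> card H = 11"
  unfolding bad_def using cycle_enum_card by metis

lemma bad_finite: "bad H \<Longrightarrow> finite H"
  using bad_card card.infinite by fastforce

text \<open>Order 3 leaves two vertices, isolated by the empty set. C7 and C11 leave paths on 6 and
  10 vertices, for which 1 and 2 vertices suffice. The saving is 3 - 0 = 7 - 4 = 11 - 8 = 3.\<close>

lemma bad_minus_vertex:
  assumes "bad H" "y \<in> H"
  shows "\<exists>D. isolating (H - {y}) D \<and> 4 * card D + 3 \<le> card H"
proof -
  consider "card H = 3" | k h where "k = 7 \<or> k = 11" "cycle_enum h k H"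
    using assms unfolding bad_def by blast
  then show ?thesis
  proof cases
    case 1
    then have "card (H - {y}) = 2" using assms bad_finite by simp
    then obtain p q where pq: "H - {y} = {p, q}" by (meson card_2_iff)
    have "isolating (H - {y}) {}" unfolding pq isolating_def by (simp add: nbhd_def)
    then show ?thesis using 1 by (intro exI[of _ "{}"]) auto
  next
    case 2
    then obtain g where g: "cycle_enum g k H" "g 0 = y" using cycle_enum_rotate assms by metis
    have bij: "bij_betw g {..<k} H"
      and adj: "\<And>i j. i < k \<Longrightarrow> j < k \<Longrightarrow> E (g i) (g j) \<longleftrightarrow> j = (i + 1) mod k \<or> i = (j + 1) mod k"
      using g unfolding cycle_enum_def by auto
    have "path_enum (g \<circ> Suc) (k - 1) (H - {y})"
      unfolding path_enum_def
    proof (intro conjI allI impI)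
      have "bij_betw g ({..<k} - {0}) (H - {g 0})"
        using bij 2(1) by (intro bij_betw_DiffI) (auto simp: bij_betw_def)
      moreover have "bij_betw Suc {..<k - 1} ({..<k} - {0})"
        by (rule bij_betw_byWitness[of _ "\<lambda>i. i - 1"]) auto
      ultimately show "bij_betw (g \<circ> Suc) {..<k - 1} (H - {y})"
        using bij_betw_trans g(2) by blast
      fix i j assume "i < k - 1" "j < k - 1"
      then show "E ((g \<circ> Suc) i) ((g \<circ> Suc) j) \<longleftrightarrow> j = i + 1 \<or> i = j + 1"
        using adj[of "Suc i" "Suc j"] by (auto simp: mod_Suc)
    qed
    from path_isolating[OF this] obtain D where D: "isolating (H - {y}) D" "card D \<le> (k - 1 + 2) div 5"
      by blast
    have "4 * card D + 3 \<le> card H" using D(2) 2(1) cycle_enum_card[OF 2(2)] by auto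
    then show ?thesis using D(1) by blast
  qed
qed

text \<open>Adding the removed vertex to the set costs 4 and turns the saving of 3 into a deficit of
  1.\<close>

lemma bad_isolating:
  assumes "bad H"
  shows "\<exists>D. isolating H D \<and> 4 * card D \<le> card H + 1"
proof -
  obtain y where y: "y \<in> H" using bad_card[OF assms] by fastforce
  obtain D where D: "isolating (H - {y}) D" "4 * card D + 3 \<le> card H"
    using bad_minus_vertex[OF assms y] by blast
  have "card (insert y D) \<le> card D + 1"
    by (metis card_insert_le_m1 card.infinite card_insert_if finite_insert le_add1 le_refl Suc_eq_plus1 zero_le)
  then show ?thesis using isolating_insert[OF D(1) y] D(2) by (intro exI[of _ "insert y D"]) auto
qed

lemma bad_deg:
  assumes "bad H" "u \<in> H"
  shows "card {w\<in>H. E u w} \<le> 2"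
proof -
  consider "card H = 3" | k h where "cycle_enum h k H"
    using assms unfolding bad_def by blast
  then show ?thesis
  proof cases
    case 1
    have "{w\<in>H. E u w} \<subseteq> H - {u}" by auto
    then have "card {w\<in>H. E u w} \<le> card (H - {u})" using bad_finite[OF assms(1)] by (intro card_mono) auto
    then show ?thesis using 1 assms bad_finite by simp
  next
    case 2
    then obtain p q where "{w\<in>H. E u w} = {p, q}" using cycle_enum_two_nbrs assms by metis
    then show ?thesis by (simp add: card_insert_if)
  qed
qed

lemma bad_cases:
  assumes "bad H" "card H \<noteq> 3"
  obtains h where "cycle_enum h (card H) H" "card H = 7 \<or> card H = 11"
  using assms cycle_enum_card unfolding bad_def by metis

text \<open>The discharging inequality behind the whole argument: a bad component of \<open>V - T\<close> costs one
  quarter more than its share, unless one of its vertices is dominated by \<open>X\<close>, in which case it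
  saves three quarters.\<close>

lemma reduction:
  assumes fin: "finite V" and XT: "X \<subseteq> T" "T \<subseteq> V"
    and dom: "\<And>t. t \<in> T \<Longrightarrow> t \<in> nbhd X \<or> (\<forall>w\<in>V. E t w \<longrightarrow> w \<in> nbhd X)"
    and IH: "\<And>C. is_component (V - T) C \<Longrightarrow> bad C \<or> good C"
  shows "\<exists>D. isolating V D \<and>
    4 * card D + 4 * card {C. is_component (V - T) C \<and> bad C \<and> (\<exists>x\<in>X. \<exists>y\<in>C. E x y)}
      \<le> 4 * card X + card (V - T) + card {C. is_component (V - T) C \<and> bad C}"
proof -
  define CC where "CC = {C. is_component (V - T) C}"
  define B where "B = {C. is_component (V - T) C \<and> bad C}"
  define BX where "BX = {C. is_component (V - T) C \<and> bad C \<and> (\<exists>x\<in>X. \<exists>y\<in>C. E x y)}"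
  have CCsub: "C \<subseteq> V - T" if "C \<in> CC" for C
    using that unfolding CC_def is_component_def closed_in_def by blast
  then have "CC \<subseteq> Pow V" by blast
  then have finCC: "finite CC" using fin finite_subset by blast
  have sub: "B \<subseteq> CC" "BX \<subseteq> CC" unfolding B_def BX_def CC_def by auto
  have un: "\<Union>CC = V - T"
    using CCsub ex_component[of _ "V - T"] unfolding CC_def by blast
  have disj: "C = C'" if "C \<in> CC" "C' \<in> CC" "C \<inter> C' \<noteq> {}" for C C'
    using that component_unique unfolding CC_def by blast
  have "card (\<Union>CC) = sum card CC"
    using disj CCsub fin by (intro card_Union_disjoint)
      (auto simp: pairwise_def disjnt_def, meson Diff_subset finite_subset order_trans)
  then have cardVT: "card (V - T) = sum card CC" using un by simp
  have "\<forall>C\<in>CC. \<exists>PD. fst PD \<subseteq> C \<and> C - fst PD \<subseteq> nbhd X \<and> isolating (fst PD) (snd PD) \<and>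
     4 * card (snd PD) + (if C \<in> BX then 4 else 0) \<le> card C + (if C \<in> B then 1 else 0)"
  proof
    fix C assume C: "C \<in> CC"
    consider "C \<in> BX" | "C \<in> B" "C \<notin> BX" | "C \<notin> B" "C \<notin> BX" "good C"
      using IH C unfolding CC_def B_def BX_def by blast
    then show "\<exists>PD. fst PD \<subseteq> C \<and> C - fst PD \<subseteq> nbhd X \<and> isolating (fst PD) (snd PD) \<and>
     4 * card (snd PD) + (if C \<in> BX then 4 else 0) \<le> card C + (if C \<in> B then 1 else 0)"
    proof cases
      case 1
      then obtain x y where xy: "x \<in> X" "y \<in> C" "E x y" "bad C" unfolding BX_def by blast
      then obtain D where D: "isolating (C - {y}) D" "4 * card D + 3 \<le> card C"
        using bad_minus_vertex by blast
      have "y \<in> nbhd X" "C \<in> B" using xy 1 unfolding nbhd_def B_def BX_def by blast+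
      then show ?thesis using 1 D by (intro exI[of _ "(C - {y}, D)"]) auto
    next
      case 2
      then obtain D where "isolating C D" "4 * card D \<le> card C + 1"
        using bad_isolating unfolding B_def by blast
      then show ?thesis using 2 by (intro exI[of _ "(C, D)"]) auto
    next
      case 3
      then obtain D where "isolating C D" "4 * card D \<le> card C" unfolding good_def by blast
      then show ?thesis using 3 by (intro exI[of _ "(C, D)"]) auto
    qed
  qed
  from bchoice[OF this] obtain PD where PD: "\<forall>C\<in>CC. fst (PD C) \<subseteq> C \<and> C - fst (PD C) \<subseteq> nbhd X \<and>
     isolating (fst (PD C)) (snd (PD C)) \<and>
     4 * card (snd (PD C)) + (if C \<in> BX then 4 else 0) \<le> card C + (if C \<in> B then 1 else 0)" ..
  define P where "P C = fst (PD C)" for C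
  define D where "D C = snd (PD C)" for C
  have P: "P C \<subseteq> C" "C - P C \<subseteq> nbhd X" "isolating (P C) (D C)"
    "4 * card (D C) + (if C \<in> BX then 4 else 0) \<le> card C + (if C \<in> B then 1 else 0)" if "C \<in> CC" for C
    using PD that unfolding P_def D_def by blast+
  have iso: "isolating (\<Union>(P ` CC)) (\<Union>(D ` CC))"
  proof (rule isolating_family)
    show "isolating (P C) (D C)" if "C \<in> CC" for C using P that by blast
    fix C C' u w assume a: "C \<in> CC" "C' \<in> CC" "u \<in> P C" "w \<in> P C'" "E u w"
    then have "u \<in> C" "w \<in> C'" "w \<in> V - T" using P CCsub by blast+
    then have "w \<in> C" using a unfolding CC_def is_component_def closed_in_def by blast
    then show "C = C'" using disj a \<open>w \<in> C'\<close> by blast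
  qed
  define DD where "DD = X \<union> \<Union>(D ` CC)"
  have nb: "nbhd X \<subseteq> nbhd DD" "nbhd (\<Union>(D ` CC)) \<subseteq> nbhd DD" unfolding DD_def nbhd_def by blast+
  have Dsub: "D C \<subseteq> V" if "C \<in> CC" for C
    using P(1,3)[OF that] CCsub[OF that] unfolding isolating_def by blast
  have "isolating V DD"
    unfolding isolating_def
  proof (intro conjI ballI impI)
    show "DD \<subseteq> V" using XT Dsub unfolding DD_def by blast
    \<comment> \<open>A vertex of \<open>T\<close> may stay undominated only if all its neighbours
      are dominated, so it lies on no edge of the remaining graph.\<close>
    have inT: False if "t \<in> T" "w \<in> V - nbhd DD" "t \<notin> nbhd DD" "E t w" for t w
      using dom[OF that(1)] nb that by blast
    have res: "w \<in> \<Union>(P ` CC) - nbhd (\<Union>(D ` CC))" if w: "w \<in> V - nbhd DD" "w \<notin> T" for w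
    proof -
      obtain C where "C \<in> CC" "w \<in> C" using un w by blast
      then have "w \<in> P C" using P(2) nb w by blast
      then show ?thesis using \<open>C \<in> CC\<close> nb w by blast
    qed
    fix u y z assume a: "u \<in> V - nbhd DD" "y \<in> V - nbhd DD" "z \<in> V - nbhd DD" "E u y" "E u z"
    then have "u \<notin> T" "y \<notin> T" "z \<notin> T" using inT sym by blast+
    then have "u \<in> \<Union>(P ` CC) - nbhd (\<Union>(D ` CC))" "y \<in> \<Union>(P ` CC) - nbhd (\<Union>(D ` CC))"
      "z \<in> \<Union>(P ` CC) - nbhd (\<Union>(D ` CC))" using res a by simp_all
    then show "y = z" using a(4,5) iso[unfolded isolating_def, THEN conjunct2] by simp
  qed
  moreover have "4 * card DD + 4 * card BX \<le> 4 * card X + card (V - T) + card B"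
  proof -
    have "card DD \<le> card X + (\<Sum>C\<in>CC. card (D C))"
      unfolding DD_def using card_Un_le[of X "\<Union>(D ` CC)"] card_UN_le[OF finCC, of D] by linarith
    moreover have "(\<Sum>C\<in>CC. 4 * card (D C) + (if C \<in> BX then 4 else 0))
        \<le> (\<Sum>C\<in>CC. card C + (if C \<in> B then 1 else 0))"
      using P(4) by (rule sum_mono)
    moreover have "(\<Sum>C\<in>CC. if C \<in> BX then 4 else 0) = 4 * card BX"
      "(\<Sum>C\<in>CC. if C \<in> B then 1 else 0) = card B"
      using sub finCC by (simp_all add: sum.If_cases Int_absorb1)
    ultimately show ?thesis using cardVT by (simp add: sum.distrib sum_distrib_left[symmetric])
  qed
  ultimately show ?thesis unfolding B_def BX_def by blast
qed

section \<open>Arcs of cycles and chordless cycles of length 5 and 6\<close>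

lemma cycle_segment:
  assumes cyc: "cycle_enum h k H" and ab: "a \<le> b" "b < k"
  shows "conn (h ` {a..b})" "card (h ` {a..b}) = b + 1 - a" "h ` {a..b} \<subseteq> H"
proof -
  have bij: "bij_betw h {..<k} H"
    and adj: "\<And>i j. i < k \<Longrightarrow> j < k \<Longrightarrow> E (h i) (h j) \<longleftrightarrow> j = (i + 1) mod k \<or> i = (j + 1) mod k"
    using cyc unfolding cycle_enum_def by auto
  show "conn (h ` {a..b})" using ab adj by (intro conn_walk) auto
  have "inj_on h {a..b}" using bij ab unfolding bij_betw_def by (auto intro: inj_on_subset)
  then show "card (h ` {a..b}) = b + 1 - a" by (simp add: card_image)
  show "h ` {a..b} \<subseteq> H" using bij ab unfolding bij_betw_def by auto
qed

lemma cycle_start_nbrs: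
  assumes "cycle_enum h k H"
  shows "{w\<in>H. E (h 0) w} = {h 1, h (k - 1)}" "h 1 \<noteq> h (k - 1)" "h 0 \<in> H" "h 1 \<in> H" "h (k - 1) \<in> H"
    "E (h 0) (h 1)"
proof -
  have k3: "3 \<le> k" and bij: "bij_betw h {..<k} H" using assms unfolding cycle_enum_def by auto
  then have m: "(0 + 1) mod k = 1" "(0 + k - 1) mod k = k - 1" "0 < k" by auto
  show *: "{w\<in>H. E (h 0) w} = {h 1, h (k - 1)}" "h 1 \<noteq> h (k - 1)"
    using cycle_enum_nbrs[OF assms m(3)] unfolding m by auto
  show "h 0 \<in> H" using bij m unfolding bij_betw_def by auto
  show "h 1 \<in> H" "h (k - 1) \<in> H" "E (h 0) (h 1)" using * by blast+
qed

lemma cycle_minus_start: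
  assumes "cycle_enum h k H" "4 \<le> k"
  shows "H - {h 0, h 1, h (k - 1)} = h ` {2..k - 2}"
proof -
  have bij: "bij_betw h {..<k} H" using assms unfolding cycle_enum_def by auto
  then have H: "H = h ` {..<k}" and inj: "inj_on h {..<k}" unfolding bij_betw_def by auto
  have "h ` {..<k} - h ` {0, 1, k - 1} = h ` ({..<k} - {0, 1, k - 1})"
    using assms(2) by (intro inj_on_image_set_diff[OF inj, symmetric]) auto
  moreover have "{..<k} - {0, 1, k - 1} = {2..k - 2}" using assms(2) by auto
  ultimately show ?thesis unfolding H by simp
qed

text \<open>Removing the closed neighbourhood of a vertex from a cycle of order 7 or 11 leaves a
  path on 4 or 8 vertices. A component inside is the whole path, and neither number is the order of
  a bad set.\<close>

lemma no_bad_in_arc: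
  assumes cyc: "cycle_enum h k H" and k: "k = 7 \<or> k = 11" and "bad C"
    and sub: "C \<subseteq> H - {h 0, h 1, h (k - 1)}"
    and cl: "\<And>u w. u \<in> C \<Longrightarrow> w \<in> H - {h 0, h 1, h (k - 1)} \<Longrightarrow> E u w \<Longrightarrow> w \<in> C"
  shows False
proof -
  have Q: "H - {h 0, h 1, h (k - 1)} = h ` {2..k - 2}" by (rule cycle_minus_start[OF cyc]) (use k in auto)
  have k2: "2 \<le> k - 2" "k - 2 < k" "k - 2 + 1 - 2 = k - 3" using k by auto
  have "conn (h ` {2..k - 2})" "card (h ` {2..k - 2}) = k - 3"
    using cycle_segment(1,2)[OF cyc k2(1,2)] k2(3) by simp_all
  moreover have "closed_in (h ` {2..k - 2}) C" using sub cl unfolding Q closed_in_def by blast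
  moreover have "C \<noteq> {}" using bad_card[OF \<open>bad C\<close>] by auto
  ultimately have "card C = k - 3" unfolding conn_def by metis
  then show False using bad_card[OF \<open>bad C\<close>] k by auto
qed

lemma conn_nbr:
  assumes "conn C" "c \<in> C" "2 \<le> card C"
  obtains z where "z \<in> C" "E c z"
proof -
  have "\<not> closed_in C {c}"
  proof
    assume "closed_in C {c}"
    then have "{c} = C" using assms(1) unfolding conn_def by blast
    then show False using assms(3) by (metis card.empty card_insert_if empty_iff finite.emptyI numeral_le_one_iff semiring_norm(69) One_nat_def)
  qed
  then show thesis using that assms(2) unfolding closed_in_def by blast
qed

lemma not_sym: "\<not> E x y \<Longrightarrow> \<not> E y x"
  using sym by blast

lemma induced_C5_enum:
  assumes "E a b" "E b c" "E c d" "E d e" "E e a"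
    and "\<not> E a c" "\<not> E a d" "\<not> E b d" "\<not> E b e" "\<not> E c e"
  shows "cycle_enum ((!) [a, b, c, d, e]) 5 {a, b, c, d, e}"
proof -
  have "distinct [a, b, c, d, e]" using assms irrefl sym by auto
  then have "bij_betw ((!) [a, b, c, d, e]) {..<5} {a, b, c, d, e}"
    by (rule bij_betw_nth) auto
  moreover have "E ([a, b, c, d, e] ! i) ([a, b, c, d, e] ! j) \<longleftrightarrow> j = (i + 1) mod 5 \<or> i = (j + 1) mod 5"
    if "i < 5" "j < 5" for i j
  proof -
    have "i \<in> {0, 1, 2, 3, 4}" "j \<in> {0, 1, 2, 3, 4}" using that by auto
    then show ?thesis
      by (elim insertE emptyE) (simp_all add: assms assms(1-5)[THEN sym] assms(6-10)[THEN not_sym])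
  qed
  ultimately show ?thesis unfolding cycle_enum_def by simp
qed

lemma induced_C6_enum:
  assumes "E a b" "E b c" "E c d" "E d e" "E e f" "E f a"
    and "\<not> E a c" "\<not> E a d" "\<not> E a e" "\<not> E b d" "\<not> E b e" "\<not> E b f" "\<not> E c e" "\<not> E c f" "\<not> E d f"
  shows "cycle_enum ((!) [a, b, c, d, e, f]) 6 {a, b, c, d, e, f}"
proof -
  have "distinct [a, b, c, d, e, f]" using assms irrefl sym by auto
  then have "bij_betw ((!) [a, b, c, d, e, f]) {..<6} {a, b, c, d, e, f}"
    by (rule bij_betw_nth) auto
  moreover have "E ([a, b, c, d, e, f] ! i) ([a, b, c, d, e, f] ! j) \<longleftrightarrow> j = (i + 1) mod 6 \<or> i = (j + 1) mod 6"
    if "i < 6" "j < 6" for i j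
  proof -
    have "i \<in> {0, 1, 2, 3, 4, 5}" "j \<in> {0, 1, 2, 3, 4, 5}" using that by auto
    then show ?thesis
      by (elim insertE emptyE) (simp_all add: assms assms(1-6)[THEN sym] assms(7-15)[THEN not_sym])
  qed
  ultimately show ?thesis unfolding cycle_enum_def by simp
qed

end

subsection \<open>A minimal counterexample\<close>

text \<open>The vertices in \<open>no_C5\<close> and \<open>no_C6\<close> need not be assumed distinct: if two of them coincided,
  one of the listed chords would be an edge of the cycle.\<close>

locale min_counterexample = ugraph +
  fixes V :: "'a set"
  assumes fin: "finite V" and con: "conn V" and nbad: "\<not> bad V" and ngood: "\<not> good V"
    and IH: "\<And>C. C \<subset> V \<Longrightarrow> conn C \<Longrightarrow> bad C \<or> good C"
    and no_C5: "\<And>a b c d e. E a b \<Longrightarrow> E b c \<Longrightarrow> E c d \<Longrightarrow> E d e \<Longrightarrow> E e a \<Longrightarrow>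
      E a c \<or> E a d \<or> E b d \<or> E b e \<or> E c e"
    and no_C6: "\<And>a b c d e f. E a b \<Longrightarrow> E b c \<Longrightarrow> E c d \<Longrightarrow> E d e \<Longrightarrow> E e f \<Longrightarrow> E f a \<Longrightarrow>
      E a c \<or> E a d \<or> E a e \<or> E b d \<or> E b e \<or> E b f \<or> E c e \<or> E c f \<or> E d f"
begin

definition nb :: "'a \<Rightarrow> 'a set" where "nb v = {u\<in>V. E v u}"

definition cnb :: "'a \<Rightarrow> 'a set" where "cnb v = insert v (nb v)"

text \<open>Once some vertex of \<open>V\<close> is deleted, all other components of the rest
  satisfy the bound by minimality, so only these enter the counting.\<close>

definition badc :: "'a set \<Rightarrow> 'a set set" where
  "badc T = {C. is_component (V - T) C \<and> bad C}"

text \<open>For a component \<open>C\<close> of \<open>V - cnb v\<close> these are all the vertices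
  of \<open>V\<close> outside \<open>C\<close> with a neighbour in \<open>C\<close>.\<close>

definition links :: "'a \<Rightarrow> 'a set \<Rightarrow> 'a set" where
  "links v C = {x\<in>nb v. \<exists>y\<in>C. E x y}"

lemma fin_badc: "finite (badc T)"
proof -
  have "badc T \<subseteq> Pow V" unfolding badc_def is_component_def closed_in_def by blast
  then show ?thesis using fin finite_subset by blast
qed

lemma fin_nb [simp]: "finite (nb v)"
  unfolding nb_def using fin by auto

lemma card_cnb: "v \<in> V \<Longrightarrow> card (cnb v) = card (nb v) + 1"
  unfolding cnb_def by (auto simp: nb_def fin)

lemma badcD:
  assumes "C \<in> badc T"
  shows "C \<subseteq> V - T" "conn C" "bad C" "C \<noteq> {}"
    "\<And>u w. u \<in> C \<Longrightarrow> w \<in> V \<Longrightarrow> E u w \<Longrightarrow> w \<in> C \<or> w \<in> T"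
  using assms unfolding badc_def is_component_def closed_in_def conn_def by blast+

text \<open>\<open>reduction\<close> read in a counterexample: the isolating set it provides must
  have more than a quarter of \<open>card V\<close> elements. \<open>T\<close> is nonempty so that
  the components are proper subsets and \<open>IH\<close> applies. The counting arguments below are
  instances with suitable \<open>T\<close> and \<open>X\<close>.\<close>

lemma ineq:
  assumes "X \<subseteq> T" "T \<subseteq> V" "T \<noteq> {}"
    and dom: "\<And>t. t \<in> T \<Longrightarrow> t \<in> nbhd X \<or> (\<forall>w\<in>V. E t w \<longrightarrow> w \<in> nbhd X)"
  shows "card T + 4 * card {C\<in>badc T. \<exists>x\<in>X. \<exists>y\<in>C. E x y} < 4 * card X + card (badc T)"
proof -
  have IH': "bad C \<or> good C" if "is_component (V - T) C" for C
    using that IH[of C] assms(2,3) unfolding is_component_def closed_in_def by blast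
  obtain D where D: "isolating V D"
    "4 * card D + 4 * card {C. is_component (V - T) C \<and> bad C \<and> (\<exists>x\<in>X. \<exists>y\<in>C. E x y)}
      \<le> 4 * card X + card (V - T) + card {C. is_component (V - T) C \<and> bad C}"
    using reduction[OF fin assms(1,2) dom IH'] by blast
  have "card V < 4 * card D" using ngood D unfolding good_def by force
  moreover have "card V = card (V - T) + card T"
    using assms(2) fin by (metis card_Diff_subset card_mono finite_subset le_add_diff_inverse2)
  moreover have "{C. is_component (V - T) C \<and> bad C \<and> (\<exists>x\<in>X. \<exists>y\<in>C. E x y)}
      = {C\<in>badc T. \<exists>x\<in>X. \<exists>y\<in>C. E x y}" unfolding badc_def by blast
  ultimately show ?thesis using D(2) unfolding badc_def by simp
qed

section \<open>Attachment of bad components and counting around a vertex\<close>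

lemma ex_link:
  assumes "C \<in> badc T" "T \<subseteq> V" "T \<noteq> {}"
  obtains u t where "u \<in> C" "t \<in> T" "E u t"
proof -
  have "\<not> closed_in V C" using con badcD[OF assms(1)] assms(2,3) unfolding conn_def by blast
  then show thesis using that badcD[OF assms(1)] unfolding closed_in_def by blast
qed

text \<open>By connectivity every component of \<open>V - {x}\<close> is adjacent to
  \<open>x\<close>. If b of them are bad, \<open>T = X = {x}\<close> gives 1 + 4b < 4 + b, so b =
  0.\<close>

lemma badc_vertex:
  assumes "x \<in> V"
  shows "badc {x} = {}"
proof -
  have "\<exists>y\<in>C. E x y" if C: "C \<in> badc {x}" for C
  proof -
    obtain u t where "u \<in> C" "t \<in> {x}" "E u t" using ex_link[OF C] assms by blast
    then show ?thesis using sym by blast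
  qed
  then have "{C\<in>badc {x}. \<exists>z\<in>{x}. \<exists>y\<in>C. E z y} = badc {x}" by auto
  then have "card {x} + 4 * card (badc {x}) < 4 * card {x} + card (badc {x})"
    using ineq[of "{x}" "{x}"] assms by (auto simp: nbhd_def)
  then show ?thesis using fin_badc by auto
qed

lemma no_cut_vertex:
  assumes "bad C" "conn C" "C \<subseteq> V" "x \<in> V" "x \<notin> C"
    and "\<And>u w. u \<in> C \<Longrightarrow> w \<in> V \<Longrightarrow> E u w \<Longrightarrow> w \<in> C \<or> w = x"
  shows False
proof -
  have "C \<in> badc {x}" using assms unfolding badc_def is_component_def closed_in_def by blast
  then show False using badc_vertex assms by blast
qed

text \<open>A single link would be a cut vertex that separates a bad component, against
  \<open>no_cut_vertex\<close>.\<close>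

lemma two_links:
  assumes v: "v \<in> V" and C: "C \<in> badc (cnb v)"
  shows "2 \<le> card (links v C)"
proof (rule ccontr)
  assume "\<not> ?thesis"
  then have le: "card (links v C) \<le> 1" by simp
  have sub: "cnb v \<subseteq> V" using v unfolding cnb_def nb_def by blast
  have vC: "\<not> E u v" if "u \<in> C" for u
    using that badcD(1)[OF C] sym unfolding cnb_def nb_def by blast
  have lk: "w \<in> links v C" if "u \<in> C" "w \<in> cnb v" "E u w" for u w
    using that vC sym unfolding links_def cnb_def by blast
  obtain u x where ux: "u \<in> C" "x \<in> cnb v" "E u x"
    using ex_link[OF C sub] unfolding cnb_def by blast
  have fl: "finite (links v C)" unfolding links_def by simp
  have uniq: "w = x" if "w \<in> links v C" for w
    using le that lk[OF ux] fl by (metis One_nat_def card_le_Suc0_iff_eq)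
  show False
  proof (rule no_cut_vertex[of C x])
    show "bad C" "conn C" "C \<subseteq> V" "x \<in> V" "x \<notin> C" using badcD[OF C] ux sub by blast+
    show "w \<in> C \<or> w = x" if "u \<in> C" "w \<in> V" "E u w" for u w
      using badcD(5)[OF C that] lk uniq that by blast
  qed
qed

text \<open>This is \<open>ineq\<close> for \<open>T = cnb v\<close> with \<open>v\<close> always
  selected. Selecting \<open>v\<close> costs 4 and \<open>v\<close> contributes 1 to
  \<open>card T\<close>, hence the constant 3; \<open>v\<close> itself is adjacent to no component
  of the rest.\<close>

lemma ineq_cnb:
  assumes "v \<in> V" "X \<subseteq> nb v"
  shows "card (nb v) + 4 * card {C\<in>badc (cnb v). \<exists>x\<in>X. \<exists>y\<in>C. E x y} < 4 * card X + 3 + card (badc (cnb v))"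
proof -
  have v: "\<not> E v y" if "y \<in> C" "C \<in> badc (cnb v)" for y C
    using that badcD(1)[OF that(2)] unfolding cnb_def nb_def by blast
  have eq: "{C\<in>badc (cnb v). \<exists>x\<in>insert v X. \<exists>y\<in>C. E x y} = {C\<in>badc (cnb v). \<exists>x\<in>X. \<exists>y\<in>C. E x y}"
    using v by blast
  have "v \<notin> X" using assms unfolding nb_def by auto
  then have "card (insert v X) = card X + 1" using assms finite_subset[OF assms(2)] by simp
  moreover have "insert v X \<subseteq> cnb v" "cnb v \<subseteq> V" "cnb v \<noteq> {}"
    using assms unfolding cnb_def nb_def by blast+
  moreover have "t \<in> nbhd (insert v X)" if "t \<in> cnb v" for t
    using that unfolding cnb_def nb_def nbhd_def by blast
  ultimately show ?thesis
    using ineq[of "insert v X" "cnb v"] card_cnb[OF assms(1)] unfolding eq by simp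
qed

text \<open>Let d be the degree and b the number of bad components. \<open>X = {}\<close> gives d
  \<le> b + 2. Omitting one neighbour from \<open>X\<close> still reaches every bad component, by
  \<open>two_links\<close>, and gives b < d. If two of them shared a link, b - 1 neighbours would
  reach all, giving d < b - 1. So the link sets are disjoint, 2b \<le> d \<le> b + 2, and d \<le>
  4.\<close>

lemma badc_count:
  assumes v: "v \<in> V" and d: "3 \<le> card (nb v)"
  shows "card (nb v) \<le> card (badc (cnb v)) + 2"
    and "\<And>C C'. C \<in> badc (cnb v) \<Longrightarrow> C' \<in> badc (cnb v) \<Longrightarrow> C \<noteq> C' \<Longrightarrow> links v C \<inter> links v C' = {}"
    and "card (nb v) \<le> 4"
proof -
  let ?B = "badc (cnb v)"
  let ?b = "card ?B"
  show low: "card (nb v) \<le> ?b + 2" using ineq_cnb[OF v, of "{}"] by auto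
  have up: "?b + 1 \<le> card (nb v)"
  proof -
    obtain x where x: "x \<in> nb v" using d by fastforce
    have "\<exists>z\<in>nb v - {x}. \<exists>y\<in>C. E z y" if C: "C \<in> ?B" for C
    proof (rule ccontr)
      assume "\<not> ?thesis"
      then have "links v C \<subseteq> {x}" unfolding links_def by blast
      then have "card (links v C) \<le> 1" using card_mono[of "{x}"] by fastforce
      then show False using two_links[OF v C] by simp
    qed
    then have "{C\<in>?B. \<exists>z\<in>nb v - {x}. \<exists>y\<in>C. E z y} = ?B" by blast
    then have "card (nb v) + 4 * ?b < 4 * card (nb v - {x}) + 3 + ?b"
      using ineq_cnb[OF v, of "nb v - {x}"] by simp
    moreover have "card (nb v - {x}) = card (nb v) - 1" using x by simp
    ultimately show ?thesis using d by linarith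
  qed
  have disj: "links v C \<inter> links v C' = {}" if C: "C \<in> ?B" "C' \<in> ?B" "C \<noteq> C'" for C C'
  proof (rule ccontr)
    assume "\<not> ?thesis"
    then obtain x where x: "x \<in> links v C" "x \<in> links v C'" by blast
    have "links v A \<noteq> {}" if "A \<in> ?B" for A using two_links[OF v that] by fastforce
    then obtain f0 where f0: "A \<in> ?B \<Longrightarrow> f0 A \<in> links v A" for A
      using that[of "\<lambda>A. SOME x. x \<in> links v A"] some_in_eq by blast
    \<comment> \<open>One link per component, with the shared link \<open>x\<close> picked for both
      \<open>C\<close> and \<open>C'\<close>, so that the image is smaller than the number of
      components.\<close>
    define f where "f A = (if A = C \<or> A = C' then x else f0 A)" for A
    have f: "f A \<in> links v A" if "A \<in> ?B" for A using that x f0 unfolding f_def by auto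
    have "f ` ?B = f ` (?B - {C'})"
      using C unfolding f_def by (auto simp: image_iff)
    then have "card (f ` ?B) \<le> card (?B - {C'})" using card_image_le[of "?B - {C'}" f] fin_badc by simp
    moreover have "card (?B - {C'}) = ?b - 1" "1 \<le> ?b" using C fin_badc by (auto simp: Suc_le_eq card_gt_0_iff)
    moreover have "{A\<in>?B. \<exists>z\<in>f ` ?B. \<exists>y\<in>A. E z y} = ?B" using f unfolding links_def by blast
    moreover have "f ` ?B \<subseteq> nb v" using f unfolding links_def by blast
    ultimately show False using ineq_cnb[OF v, of "f ` ?B"] up by simp
  qed
  then show "\<And>C C'. C \<in> ?B \<Longrightarrow> C' \<in> ?B \<Longrightarrow> C \<noteq> C' \<Longrightarrow> links v C \<inter> links v C' = {}" by blast
  have "2 * ?b \<le> (\<Sum>C\<in>?B. card (links v C))"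
    using sum_mono[of ?B "\<lambda>_. 2" "\<lambda>C. card (links v C)"] two_links[OF v] by simp
  also have "\<dots> = card (\<Union>C\<in>?B. links v C)"
    using disj fin_badc by (subst card_UN_disjoint) (auto simp: links_def)
  also have "\<dots> \<le> card (nb v)" by (rule card_mono) (auto simp: links_def)
  finally show "card (nb v) \<le> 4" using low by linarith
qed

subsection \<open>Bad components that are cycles\<close>

lemma mem_nb: "w \<in> nb u \<longleftrightarrow> w \<in> V \<and> E u w"
  unfolding nb_def by blast

lemma not_adj:
  assumes "C \<in> badc (cnb v)" "u \<in> C"
  shows "\<not> E v u" "\<not> E u v" "u \<noteq> v" "u \<in> V" "u \<notin> nb v"
  using badcD(1)[OF assms(1)] assms(2) sym unfolding cnb_def nb_def by blast+

lemma badc_nbr: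
  assumes "C \<in> badc (cnb v)" "u \<in> C" "w \<in> V" "E u w"
  shows "w \<in> C \<or> w \<in> nb v"
  using badcD(5)[OF assms] not_adj[OF assms(1,2)] assms(4) unfolding cnb_def by blast

lemma badc_nonempty:
  assumes "v \<in> V" "3 \<le> card (nb v)"
  obtains C where "C \<in> badc (cnb v)"
proof -
  have "badc (cnb v) \<noteq> {}" using badc_count(1)[OF assms] assms(2) by auto
  then show thesis using that by blast
qed

text \<open>Since \<open>v\<close> is not deleted, a component with a member of \<open>nb v\<close>
  would contain \<open>v\<close>. So \<open>C\<close> lies in \<open>V - cnb v\<close>, inside
  \<open>H\<close> or disjoint from it; if disjoint, it is attached through \<open>x\<close> alone,
  against \<open>no_cut_vertex\<close>.\<close>

lemma badc_away_from:
  assumes v: "v \<in> V" and H: "H \<in> badc (cnb v)" and T: "T \<subseteq> insert x H" "x \<in> nb v" "x \<in> T"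
    and C: "C \<in> badc T" "v \<notin> C"
  shows "C \<subseteq> H"
proof -
  have vT: "v \<notin> T" using T not_adj[OF H] irrefl unfolding nb_def by blast
  have CV: "C \<subseteq> V" using badcD(1)[OF C(1)] by blast
  have 1: "C \<inter> nb v = {}"
  proof (rule ccontr)
    assume "C \<inter> nb v \<noteq> {}"
    then obtain w where "w \<in> C" "E w v" using sym unfolding nb_def by blast
    then show False using badcD(5)[OF C(1)] v C(2) vT by blast
  qed
  then have sub: "C \<subseteq> V - cnb v" using C CV unfolding cnb_def by blast
  have clH: "closed_in (V - cnb v) H" using H unfolding badc_def is_component_def by blast
  show ?thesis
  proof (cases "C \<inter> H = {}")
    case True
    have False
    proof (rule no_cut_vertex[of C x])
      show "bad C" "conn C" "C \<subseteq> V" "x \<in> V" "x \<notin> C"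
        using badcD[OF C(1)] T unfolding nb_def by blast+
      fix u w assume uw: "u \<in> C" "w \<in> V" "E u w"
      have "w \<notin> H"
        using clH uw sym sub True unfolding closed_in_def by blast
      then show "w \<in> C \<or> w = x" using badcD(5)[OF C(1) uw] T by blast
    qed
    then show ?thesis ..
  next
    case False
    then show ?thesis using conn_subset_closed[OF badcD(2)[OF C(1)] sub clH] by blast
  qed
qed

text \<open>Inside a bad component \<open>v\<close> has at most two neighbours, and \<open>x\<close>
  is the only one that can be missing.\<close>

lemma deg_from_badc:
  assumes v: "v \<in> V" and C: "C \<in> badc T" "v \<in> C" and T: "T \<inter> nb v \<subseteq> {x}"
  shows "card (nb v) \<le> 3"
proof -
  have "nb v \<subseteq> insert x {w\<in>C. E v w}"
    using badcD(5)[OF C(1,2)] T unfolding nb_def by blast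
  moreover have f: "finite {w\<in>C. E v w}" using bad_finite[OF badcD(3)[OF C(1)]] by simp
  ultimately have "card (nb v) \<le> card (insert x {w\<in>C. E v w})" by (intro card_mono) auto
  also have "\<dots> \<le> card {w\<in>C. E v w} + 1" using f by (simp add: card_insert_if)
  finally show ?thesis using bad_deg[OF badcD(3)[OF C(1)] C(2)] by simp
qed

text \<open>If the four vertices of \<open>insert x H\<close> can be settled by a single vertex
  \<open>y\<close>, both sides of \<open>ineq\<close> start from 4 and a bad component
  \<open>K\<close> must exist. By \<open>badc_away_from\<close> it contains \<open>v\<close>, which
  bounds the degree of \<open>v\<close>.\<close>

lemma small_component:
  assumes v: "v \<in> V" and H: "H \<in> badc (cnb v)" and H3: "card H = 3"
  obtains x K where "x \<in> links v H" "K \<in> badc (insert x H)" "v \<in> K" "card (nb v) \<le> 3"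
proof -
  note na = not_adj[OF H]
  have HV: "H \<subseteq> V" using na(4) by blast
  have nbv: "w \<in> H \<or> w \<in> nb v" if "u \<in> H" "w \<in> V" "E u w" for u w
    using badc_nbr[OF H that] .
  \<comment> \<open>Choice of \<open>y\<close>: a linked vertex of \<open>H\<close> adjacent to the
    rest of \<open>H\<close>, if there is one. Otherwise \<open>H\<close> is a path
    \<open>a\<close>, \<open>b\<close>, \<open>c\<close> with \<open>a\<close> linked, and
    \<open>y\<close> is \<open>a\<close> if \<open>c\<close> is not linked, or else a vertex of
    \<open>nb v\<close> adjacent to both \<open>a\<close> and \<open>c\<close>.\<close>
  have "\<exists>x\<in>links v H. \<exists>y\<in>insert x H. \<forall>t\<in>insert x H. t \<in> nbhd {y} \<or> (\<forall>w\<in>V. E t w \<longrightarrow> w \<in> nbhd {y})"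
  proof (cases "\<exists>y\<in>H. \<exists>x\<in>nb v. E x y \<and> (\<forall>z\<in>H. z = y \<or> E y z)")
    case True
    then obtain x y where "y \<in> H" "x \<in> nb v" "E x y" "\<forall>z\<in>H. z = y \<or> E y z" by blast
    then show ?thesis using sym unfolding links_def nbhd_def
      by (intro bexI[of _ x] bexI[of _ y]) auto
  next
    case False
    have "links v H \<noteq> {}" using two_links[OF v H] by auto
    then obtain x a where xa: "x \<in> nb v" "a \<in> H" "E x a" unfolding links_def by blast
    then obtain c where c: "c \<in> H" "c \<noteq> a" "\<not> E a c" using False by blast
    obtain b where b: "b \<in> H" "b \<noteq> a" "b \<noteq> c" "E a b" "E b c" "H = {a, b, c}"
      using conn_three_adj[OF badcD(2)[OF H] H3 xa(2) c(1) c(2)[symmetric] c(3)] insert_commute[of _ c]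
      by metis
    have bl: "\<not> E z b" "\<not> E b z" if "z \<in> nb v" for z
      using False b that sym by blast+
    show ?thesis
    proof (cases "\<exists>z\<in>nb v. E z c")
      case no: False
      have "w \<in> nbhd {a}" if "w \<in> V" "E c w" for w
      proof -
        have "w \<in> H" using nbv[of c w] that c no sym by blast
        then have "w = b" using that c b irrefl sym by blast
        then show ?thesis using b unfolding nbhd_def by blast
      qed
      then show ?thesis
        using xa b sym unfolding links_def nbhd_def
        by (intro bexI[of _ x] bexI[of _ a]) auto
    next
      case True
      \<comment> \<open>Without a common link, \<open>x\<close>, \<open>a\<close>, \<open>b\<close>,
        \<open>c\<close>, \<open>x'\<close> form an induced 5-cycle if \<open>x\<close> and
        \<open>x'\<close> are adjacent, and an induced 6-cycle together with \<open>v\<close> if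
        not.\<close>
      have "\<exists>z\<in>nb v. E z a \<and> E z c"
      proof (rule ccontr)
        assume nc: "\<not> ?thesis"
        obtain x' where x': "x' \<in> nb v" "E x' c" using True by blast
        have n: "\<not> E x c" "\<not> E x' a" "\<not> E a x'" "\<not> E a c" using nc xa x' c sym by blast+
        have e: "E v x" "E x' v" "E c x'" using xa x' sym unfolding nb_def by blast+
        have nv: "\<not> E v a" "\<not> E v b" "\<not> E v c" using na b by blast+
        show False
        proof (cases "E x x'")
          case True
          then show False
            using no_C5[of x a b c x'] xa b e n bl[OF xa(1)] bl[OF x'(1)] sym by blast
        next
          case False
          then show False
            using no_C6[of v x a b c x'] xa b e n nv bl[OF xa(1)] bl[OF x'(1)] by blast
        qed
      qed
      then obtain z where z: "z \<in> nb v" "E z a" "E z c" by blast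
      have "w \<in> nbhd {z}" if "w \<in> V" "E b w" for w
      proof -
        have "w \<in> H" using nbv[of b w] that b bl by blast
        then have "w = a \<or> w = c" using that b irrefl by blast
        then show ?thesis using z unfolding nbhd_def by blast
      qed
      then show ?thesis
        using z b sym unfolding links_def nbhd_def
        by (intro bexI[of _ z] bexI[of _ z]) auto
    qed
  qed
  then obtain x y where x: "x \<in> links v H" and y: "y \<in> insert x H"
    and dom: "\<And>t. t \<in> insert x H \<Longrightarrow> t \<in> nbhd {y} \<or> (\<forall>w\<in>V. E t w \<longrightarrow> w \<in> nbhd {y})" by blast
  have xn: "x \<in> nb v" "x \<in> V" "x \<notin> H" using x na unfolding links_def nb_def by blast+
  have "card (insert x H) = 4" using xn H3 bad_finite[OF badcD(3)[OF H]] by simp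
  then have "badc (insert x H) \<noteq> {}"
    using ineq[of "{y}" "insert x H"] y dom xn HV by auto
  then obtain K where K: "K \<in> badc (insert x H)" by blast
  have "v \<in> K"
  proof (rule ccontr)
    assume "v \<notin> K"
    then have "K \<subseteq> H" using badc_away_from[OF v H _ xn(1) _ K] by blast
    then show False using badcD(1,4)[OF K] by blast
  qed
  moreover have "card (nb v) \<le> 3"
    using deg_from_badc[OF v K \<open>v \<in> K\<close>, of x] na(5) by blast
  ultimately show thesis using that x K by blast
qed

text \<open>Now \<open>h 0\<close> has degree 4, so two bad components of
  \<open>V - cnb (h 0)\<close> share its four neighbours two and two. The one linked to
  \<open>h 1\<close> cannot contain \<open>v\<close>, which would add both \<open>x\<close> and
  \<open>x'\<close> to its links. So it stays within \<open>H\<close>, in an arc where no bad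
  component fits.\<close>

lemma cycle_no_double_link:
  assumes v: "v \<in> V" and H: "H \<in> badc (cnb v)" and cyc: "cycle_enum h k H" "k = 7 \<or> k = 11"
    and x: "x \<in> nb v" "x' \<in> nb v" "x \<noteq> x'" "E x (h 0)" "E x' (h 0)"
  shows False
proof -
  note na = not_adj[OF H]
  note st = cycle_start_nbrs[OF cyc(1)]
  define hp where "hp = h 1"
  define hm where "hm = h (k - 1)"
  have hh: "hp \<in> H" "hm \<in> H" "hp \<noteq> hm" "E (h 0) hp" "E (h 0) hm"
    using st unfolding hp_def hm_def by blast+
  have h0: "h 0 \<in> V" using na(4) st(3) by blast
  have ds: "distinct [hp, hm, x, x']" using hh x na(5) by auto
  have "{hp, hm, x, x'} \<subseteq> nb (h 0)"
    using hh x na(4) sym unfolding nb_def by blast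
  moreover have c4: "card {hp, hm, x, x'} = 4" using ds by simp
  ultimately have ge: "4 \<le> card (nb (h 0))" using card_mono[OF fin_nb] by metis
  then have d: "3 \<le> card (nb (h 0))" by simp
  have nb0: "nb (h 0) = {hp, hm, x, x'}"
    using card_seteq[OF fin_nb \<open>{hp, hm, x, x'} \<subseteq> nb (h 0)\<close>] badc_count(3)[OF h0 d] c4 by simp
  have "2 \<le> card (badc (cnb (h 0)))" using badc_count(1)[OF h0 d] ge by simp
  then obtain C1 C2 where C: "C1 \<in> badc (cnb (h 0))" "C2 \<in> badc (cnb (h 0))" "C1 \<noteq> C2"
    by (metis card_le_Suc0_iff_eq fin_badc not_less_eq_eq numeral_2_eq_2)
  have lt: "links (h 0) C1 \<inter> links (h 0) C2 = {}" using badc_count(2)[OF h0 d C] .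
  have f: "finite (links (h 0) A)" for A unfolding links_def by simp
  have sub: "links (h 0) C1 \<union> links (h 0) C2 \<subseteq> nb (h 0)" unfolding links_def by blast
  have cu: "card (links (h 0) C1 \<union> links (h 0) C2) = card (links (h 0) C1) + card (links (h 0) C2)"
    using card_Un_disjoint[OF f f lt] .
  have le4: "card (links (h 0) C1) + card (links (h 0) C2) \<le> 4"
    using card_mono[OF fin_nb sub] cu nb0 c4 by simp
  have two: "2 \<le> card (links (h 0) C1)" "2 \<le> card (links (h 0) C2)" using two_links[OF h0] C by blast+
  have "links (h 0) C1 \<union> links (h 0) C2 = nb (h 0)"
    using card_seteq[OF fin_nb sub] cu two nb0 c4 by simp
  then have "hp \<in> links (h 0) C1 \<or> hp \<in> links (h 0) C2" using nb0 by blast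
  moreover have "card (links (h 0) C1) \<le> 2" "card (links (h 0) C2) \<le> 2" using two le4 by linarith+
  ultimately obtain C where C: "C \<in> badc (cnb (h 0))" "hp \<in> links (h 0) C" "card (links (h 0) C) \<le> 2"
    using C(1,2) by metis
  have vT: "v \<notin> cnb (h 0)" using na st(3) v unfolding cnb_def nb_def by blast
  have cnb0: "cnb (h 0) = {h 0, hp, hm, x, x'}" using nb0 unfolding cnb_def by blast
  have vC: "v \<notin> C"
  proof
    assume "v \<in> C"
    moreover have "E x v" "E x' v" using x sym unfolding nb_def by blast+
    ultimately have "{hp, x, x'} \<subseteq> links (h 0) C" using C(2) nb0 unfolding links_def by blast
    then have "card {hp, x, x'} \<le> 2" using card_mono[OF f] C(3) by (meson le_trans)
    then show False using ds by simp
  qed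
  have nv: "C \<inter> nb v = {}"
  proof (rule ccontr)
    assume "C \<inter> nb v \<noteq> {}"
    then obtain w where "w \<in> C" "E w v" using sym unfolding nb_def by blast
    then show False using badcD(5)[OF C(1)] v vC vT by blast
  qed
  obtain w where w: "w \<in> C" "E hp w" using C(2) unfolding links_def by blast
  then have "w \<in> H" using badc_nbr[OF H hh(1)] badcD(1)[OF C(1)] nv by blast
  moreover have clH: "closed_in (V - cnb v) H" using H unfolding badc_def is_component_def by blast
  moreover have "C \<subseteq> V - cnb v" using badcD(1)[OF C(1)] nv vC unfolding cnb_def by blast
  ultimately have CH: "C \<subseteq> H" using conn_subset_closed[OF badcD(2)[OF C(1)]] w by blast
  show False
  proof (rule no_bad_in_arc[OF cyc badcD(3)[OF C(1)]])
    show "C \<subseteq> H - {h 0, h 1, h (k - 1)}"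
      using CH badcD(1)[OF C(1)] unfolding cnb0 hp_def hm_def by blast
    fix u w assume "u \<in> C" "w \<in> H - {h 0, h 1, h (k - 1)}" "E u w"
    moreover from this have "w \<in> V" "w \<notin> cnb (h 0)"
      using na x unfolding cnb0 hp_def hm_def by blast+
    ultimately show "w \<in> C" using badcD(5)[OF C(1)] by blast
  qed
qed

text \<open>As \<open>h 0\<close> has degree 3, some bad component of \<open>V - cnb (h 0)\<close>
  exists. It does not fit into the remaining arc of \<open>H\<close>, hence contains
  \<open>v\<close>, and \<open>x\<close> is the only neighbour of \<open>v\<close> that is
  deleted.\<close>

lemma cycle_link:
  assumes v: "v \<in> V" and H: "H \<in> badc (cnb v)" and cyc: "cycle_enum h k H" "k = 7 \<or> k = 11"
    and x: "x \<in> nb v" "E x (h 0)"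
  shows "nb (h 0) = {h 1, h (k - 1), x}" "card (nb (h 0)) = 3" "card (nb v) \<le> 3"
    "\<exists>K\<in>badc (cnb (h 0)). v \<in> K"
proof -
  note na = not_adj[OF H]
  note st = cycle_start_nbrs[OF cyc(1)]
  have h0: "h 0 \<in> V" using na(4) st(3) by blast
  have "w \<in> {h 1, h (k - 1), x}" if w: "w \<in> nb (h 0)" for w
  proof -
    have "w \<in> H \<or> w \<in> nb v" using badc_nbr[OF H st(3)] w unfolding nb_def by blast
    then show ?thesis
    proof
      assume "w \<in> H" then show ?thesis using st(1) w unfolding nb_def by blast
    next
      assume "w \<in> nb v"
      then show ?thesis using cycle_no_double_link[OF v H cyc x(1) _ _ x(2)] w sym unfolding nb_def by blast
    qed
  qed
  moreover have "{h 1, h (k - 1), x} \<subseteq> nb (h 0)"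
    using st na(4) x sym unfolding nb_def by blast
  ultimately show nb0: "nb (h 0) = {h 1, h (k - 1), x}" by blast
  have "h 1 \<noteq> x" "h (k - 1) \<noteq> x" using na(5) st x by blast+
  then show c3: "card (nb (h 0)) = 3" using nb0 st(2) by simp
  have sub: "cnb (h 0) \<subseteq> insert x H" using nb0 st unfolding cnb_def by auto
  have xT: "x \<in> cnb (h 0)" using nb0 unfolding cnb_def by blast
  obtain K where K: "K \<in> badc (cnb (h 0))" using badc_nonempty[OF h0] c3 by auto
  have vK: "v \<in> K"
  proof (rule ccontr)
    assume "v \<notin> K"
    then have KH: "K \<subseteq> H" using badc_away_from[OF v H sub x(1) xT K] by blast
    show False
    proof (rule no_bad_in_arc[OF cyc badcD(3)[OF K]])
      show "K \<subseteq> H - {h 0, h 1, h (k - 1)}"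
        using KH badcD(1)[OF K] nb0 unfolding cnb_def by blast
      fix u w assume "u \<in> K" "w \<in> H - {h 0, h 1, h (k - 1)}" "E u w"
      moreover from this have "w \<in> V" "w \<notin> cnb (h 0)"
        using na x nb0 unfolding cnb_def by blast+
      ultimately show "w \<in> K" using badcD(5)[OF K] by blast
    qed
  qed
  then show "\<exists>K\<in>badc (cnb (h 0)). v \<in> K" using K by blast
  show "card (nb v) \<le> 3"
    using deg_from_badc[OF v K vK, of x] sub na(5) by blast
qed

lemma linked_cycle:
  assumes v: "v \<in> V" and H: "H \<in> badc (cnb v)" and "card H \<noteq> 3"
  obtains h k x where "cycle_enum h k H" "k = 7 \<or> k = 11" "x \<in> nb v" "E x (h 0)"
proof -
  obtain h0 where h0: "cycle_enum h0 (card H) H" "card H = 7 \<or> card H = 11"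
    using bad_cases[OF badcD(3)[OF H] assms(3)] by metis
  have "links v H \<noteq> {}" using two_links[OF v H] by auto
  then obtain x y where xy: "x \<in> nb v" "y \<in> H" "E x y" unfolding links_def by blast
  obtain g where "cycle_enum g (card H) H" "g 0 = y" using cycle_enum_rotate[OF h0(1) xy(2)] .
  then show thesis using that[of g "card H" x] h0(2) xy by simp
qed

lemma deg_le_3: "v \<in> V \<Longrightarrow> card (nb v) \<le> 3"
proof (rule ccontr)
  assume v: "v \<in> V" and "\<not> card (nb v) \<le> 3"
  then obtain H where H: "H \<in> badc (cnb v)" using badc_nonempty by (metis nat_le_linear)
  show False
  proof (cases "card H = 3")
    case True
    then show False using small_component[OF v H] \<open>\<not> card (nb v) \<le> 3\<close> by metis
  next
    case False
    then show False using linked_cycle[OF v H] cycle_link(3)[OF v H] \<open>\<not> card (nb v) \<le> 3\<close> by metis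
  qed
qed

text \<open>With the degree bound, three known neighbours determine a neighbourhood; many
  nonadjacencies below are read off from such lists.\<close>

lemma nb_full:
  assumes "u \<in> V" "a \<in> nb u" "b \<in> nb u" "c \<in> nb u" "a \<noteq> b" "a \<noteq> c" "b \<noteq> c"
  shows "nb u = {a, b, c}"
proof -
  have "{a, b, c} \<subseteq> nb u" "card {a, b, c} = 3" using assms by auto
  then show ?thesis using card_seteq[OF fin_nb] deg_le_3[OF assms(1)] by metis
qed

text \<open>\<open>x\<close> and \<open>x'\<close> are adjacent, as \<open>v\<close>,
  \<open>x\<close>, \<open>g 0\<close>, \<open>g 1\<close>, \<open>x'\<close> would otherwise be an
  induced 5-cycle; this completes both neighbourhoods. A bad component of \<open>V - cnb x\<close>
  then contains all of \<open>H\<close> except \<open>g 0\<close>. Being so large it is a cycle, but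
  \<open>g 1\<close> keeps at most one neighbour in it.\<close>

lemma cycle_no_adjacent_links:
  assumes v: "v \<in> V" and H: "H \<in> badc (cnb v)" and cyc: "cycle_enum g k H" "k = 7 \<or> k = 11"
    and x: "x \<in> nb v" "x' \<in> nb v" "x \<noteq> x'" "E x (g 0)" "E x' (g 1)"
  shows False
proof -
  note na = not_adj[OF H]
  note st = cycle_start_nbrs[OF cyc(1)]
  have xV: "x \<in> V" "x' \<in> V" "E v x" "E v x'" "E x v" "E x' v" "x \<notin> H" "x' \<notin> H"
    using x sym na unfolding nb_def by blast+
  obtain g' where g': "cycle_enum g' k H" "g' 0 = g 1" "g' 1 = g 0"
    using cycle_enum_start[OF cyc(1) st(4,3)] st(6) sym by metis
  have nb0: "nb (g 0) = {g 1, g (k - 1), x}" using cycle_link(1)[OF v H cyc x(1,4)] .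
  obtain q where nb1: "nb (g 1) = {g 0, q, x'}"
    using cycle_link(1)[OF v H g'(1) cyc(2) x(2)] g' x(5) by metis
  have qx: "x \<notin> nb (g 1)" "x' \<notin> nb (g 0)"
  proof -
    show "x' \<notin> nb (g 0)" using st(4,5) xV(8) x(3) unfolding nb0 by auto
    have "E x (g' 0)" if "x \<in> nb (g 1)" using that g'(2) sym[of "g 1" x] unfolding nb_def by simp
    then show "x \<notin> nb (g 1)"
      using cycle_no_double_link[OF v H g'(1) cyc(2) x(1,2,3)] x(5) g'(2) by metis
  qed
  have adj: "E x x'"
  proof -
    have "\<not> E v (g 0)" "\<not> E v (g 1)" using na(1) st(3,4) by blast+
    moreover have "\<not> E x (g 1)" using qx(1) xV(1) sym unfolding nb_def by blast
    moreover have "\<not> E (g 0) x'" using qx(2) xV(2) unfolding nb_def by blast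
    ultimately show ?thesis using no_C5[OF xV(3) x(4) st(6) sym[OF x(5)] xV(6)] by blast
  qed
  have gV: "g 0 \<in> V" "g 1 \<in> V" "g 0 \<noteq> v" "g 1 \<noteq> v" using na st by blast+
  have ne: "v \<noteq> x" "v \<noteq> x'" "g 0 \<noteq> x'" "g 1 \<noteq> x" using xV st(3,4) irrefl by metis+
  have nbx: "nb x = {v, g 0, x'}"
    by (rule nb_full) (use xV x(4) adj gV v ne in \<open>auto simp: mem_nb\<close>)
  have nbx': "nb x' = {v, g 1, x}"
    by (rule nb_full) (use xV x(5) adj gV v ne sym in \<open>auto simp: mem_nb\<close>)
  have "card (nb x) = 3" unfolding nbx using gV ne by simp
  then obtain C where C: "C \<in> badc (cnb x)" using badc_nonempty[OF xV(1)] by auto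
  have CV: "C \<subseteq> V" using badcD(1)[OF C] by blast
  have cnbx: "cnb x = {x, v, g 0, x'}" using nbx unfolding cnb_def by blast
  \<comment> \<open>The link \<open>v\<close> alone is not enough, so the component is entered from
    \<open>g 0\<close> or \<open>x'\<close>, whose neighbours outside \<open>cnb x\<close> are among
    \<open>g 1\<close> and \<open>g (k - 1)\<close>.\<close>
  have "\<exists>y\<in>C. y = g 1 \<or> y = g (k - 1)"
  proof -
    have "links x C \<subseteq> {v, g 0, x'}" using nbx unfolding links_def by blast
    moreover have "\<not> links x C \<subseteq> {v}"
    proof
      assume "links x C \<subseteq> {v}"
      then have "card (links x C) \<le> 1" using card_mono[of "{v}"] by fastforce
      then show False using two_links[OF xV(1) C] by simp
    qed
    ultimately obtain y where y: "y \<in> C" "E (g 0) y \<or> E x' y" unfolding links_def by blast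
    then have "y \<in> nb (g 0) \<or> y \<in> nb x'" using CV unfolding nb_def by blast
    moreover have "y \<notin> {x, v, g 0, x'}" using badcD(1)[OF C] y cnbx by blast
    ultimately show ?thesis using y nb0 nbx' by blast
  qed
  then obtain y where y: "y \<in> C" "y = g 1 \<or> y = g (k - 1)" by blast
  have k: "1 \<le> k - 1" "k - 1 < k" using cyc(2) by auto
  note seg = cycle_segment[OF cyc(1) k]
  have "g 0 \<notin> g ` {1..k - 1}"
  proof -
    have "inj_on g {..<k}" using cyc(1) unfolding cycle_enum_def bij_betw_def by blast
    have ne: "g 0 \<noteq> g i" if "1 \<le> i" "i \<le> k - 1" for i
    proof
      assume "g 0 = g i"
      moreover have "i < k" "0 < k" using that k by linarith+
      ultimately show False using \<open>inj_on g {..<k}\<close> that(1) by (auto dest: inj_onD)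
    qed
    show ?thesis
    proof
      assume "g 0 \<in> g ` {1..k - 1}"
      then obtain i where "i \<in> {1..k - 1}" "g 0 = g i" by (rule imageE)
      then show False using ne[of i] by simp
    qed
  qed
  then have "g ` {1..k - 1} \<subseteq> V - cnb x" using seg(3) na xV unfolding cnbx by blast
  moreover have "closed_in (V - cnb x) C" using C unfolding badc_def is_component_def by blast
  moreover have "y \<in> g ` {1..k - 1}" using y k by auto
  ultimately have segC: "g ` {1..k - 1} \<subseteq> C" using conn_subset_closed[OF seg(1)] y by blast
  then have "k - 1 \<le> card C"
    using card_mono[OF bad_finite[OF badcD(3)[OF C]] segC] seg(2) by simp
  then have "card C \<noteq> 3" using cyc(2) by auto
  then obtain f where f: "cycle_enum f (card C) C" using bad_cases[OF badcD(3)[OF C]] by metis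
  have "g 1 \<in> C" using segC k by auto
  then obtain p r where pr: "p \<noteq> r" "{w\<in>C. E (g 1) w} = {p, r}" using cycle_enum_two_nbrs[OF f] by metis
  then have "p \<in> C" "r \<in> C" "p \<in> nb (g 1)" "r \<in> nb (g 1)" using CV unfolding nb_def by blast+
  then show False using nb1 pr(1) badcD(1)[OF C] cnbx by blast
qed

text \<open>The bad component \<open>K\<close> of \<open>V - cnb (h 0)\<close> around
  \<open>v\<close> holds all of \<open>nb v\<close> except \<open>x\<close>. If \<open>K\<close>
  meets the arc of \<open>H\<close> opposite \<open>h 0\<close>, it contains this arc and is a
  cycle; then \<open>h 2\<close> has a link \<open>x'\<close>, and \<open>x\<close>,
  \<open>h 0\<close>, \<open>h 1\<close>, \<open>h 2\<close>, \<open>x'\<close> close an induced 5-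
  or 6-cycle. If not, a second link of \<open>H\<close> ends at a neighbour of \<open>h 0\<close>,
  against \<open>cycle_no_adjacent_links\<close>.\<close>

lemma badc_card_3:
  assumes v: "v \<in> V" and H: "H \<in> badc (cnb v)"
  shows "card H = 3"
proof (rule ccontr)
  assume "card H \<noteq> 3"
  then obtain h k x where cyc: "cycle_enum h k H" "k = 7 \<or> k = 11" and x: "x \<in> nb v" "E x (h 0)"
    using linked_cycle[OF v H] by metis
  note na = not_adj[OF H]
  note st = cycle_start_nbrs[OF cyc(1)]
  have nb0: "nb (h 0) = {h 1, h (k - 1), x}" using cycle_link(1)[OF v H cyc x] .
  obtain K where K: "K \<in> badc (cnb (h 0))" "v \<in> K" using cycle_link(4)[OF v H cyc x] by blast
  have cnb0: "cnb (h 0) = {h 0, h 1, h (k - 1), x}" using nb0 unfolding cnb_def by blast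
  have xV: "x \<in> V" "E v x" "E x v" "x \<notin> H" using x sym na unfolding nb_def by blast+
  have toK: "x' \<in> K" if "x' \<in> nb v" "x' \<noteq> x" for x'
  proof -
    have "x' \<in> V" "E v x'" "x' \<notin> cnb (h 0)" using that na st unfolding cnb0 nb_def by blast+
    then show ?thesis using badcD(5)[OF K] by blast
  qed
  have k: "2 \<le> k - 2" "k - 2 < k" using cyc(2) by auto
  note seg = cycle_segment[OF cyc(1) k]
  have Q: "H - {h 0, h 1, h (k - 1)} = h ` {2..k - 2}"
    by (rule cycle_minus_start[OF cyc(1)]) (use cyc(2) in auto)
  have QT: "h ` {2..k - 2} \<subseteq> V - cnb (h 0)" using na xV unfolding cnb0 Q[symmetric] by blast
  show False
  proof (cases "h ` {2..k - 2} \<inter> K = {}")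
    case False
    have "closed_in (V - cnb (h 0)) K" using K unfolding badc_def is_component_def by blast
    then have QK: "h ` {2..k - 2} \<subseteq> K" using conn_subset_closed[OF seg(1) QT] False by blast
    then have "k - 3 \<le> card K"
      using card_mono[OF bad_finite[OF badcD(3)[OF K(1)]] QK] seg(2) by simp
    then have "card K \<noteq> 3" using cyc(2) by auto
    then obtain f where f: "cycle_enum f (card K) K" using bad_cases[OF badcD(3)[OF K(1)]] by metis
    have h2: "h 2 \<in> K" "h 2 \<in> H" using QK k seg(3) by auto
    obtain p r where pr: "p \<noteq> r" "p \<in> K" "r \<in> K" "{w\<in>K. E (h 2) w} = {p, r}"
      using cycle_enum_two_nbrs[OF f h2(1)] by metis
    have nbH2: "{w\<in>H. E (h 2) w} = {h 3, h 1}"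
    proof -
      have m: "(2 + 1) mod k = 3" "(2 + k - 1) mod k = 1" "2 < k" using cyc(2) by auto
      show ?thesis using cycle_enum_nbrs(1)[OF cyc(1) m(3)] unfolding m .
    qed
    have KV: "K \<subseteq> V" "h 1 \<notin> K" "x \<notin> K" using badcD(1)[OF K(1)] unfolding cnb0 by blast+
    \<comment> \<open>On the cycle \<open>K\<close> the vertex \<open>h 2\<close> has two
      neighbours. As \<open>h 1\<close> is deleted, \<open>H\<close> supplies only
      \<open>h 3\<close>, so the other one lies in \<open>nb v\<close>.\<close>
    have "\<exists>x'\<in>nb v. x' \<in> K \<and> E (h 2) x'"
    proof (rule ccontr)
      assume no: "\<not> ?thesis"
      have "w = h 3" if "w \<in> {p, r}" for w
      proof -
        have "w \<in> K" "E (h 2) w" using that pr(4) by blast+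
        then have "w \<in> H" using badc_nbr[OF H h2(2)] no KV by blast
        then show ?thesis using nbH2 \<open>w \<in> K\<close> \<open>E (h 2) w\<close> KV by blast
      qed
      then show False using pr(1) by blast
    qed
    then obtain x' where x': "x' \<in> nb v" "x' \<in> K" "E (h 2) x'" by blast
    then have ne: "x \<noteq> x'" "E x' (h 2)" using KV sym by blast+
    have ev: "E v x'" "E x' v" "x' \<notin> H" "x' \<in> V" using x' sym na unfolding nb_def by blast+
    have h12: "E (h 1) (h 2)" using nbH2 st(4) sym by blast
    have "\<not> E (h 0) (h 2)"
    proof -
      have "h 2 \<in> H - {h 0, h 1, h (k - 1)}" using Q k by auto
      then show ?thesis using st(1) by blast
    qed
    have n1: "\<not> E x' (h 1)" using cycle_no_adjacent_links[OF v H cyc x(1) x'(1) ne(1) x(2)] by blast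
    have n2: "\<not> E x (h 1)"
    proof
      assume "E x (h 1)"
      moreover obtain g where "cycle_enum g k H" "g 0 = h 1" "g 1 = h 2"
        using cycle_enum_start[OF cyc(1) st(4) h2(2) h12] by metis
      ultimately show False
        using cycle_no_adjacent_links[OF v H _ cyc(2) x(1) x'(1) ne(1)] ne(2) by metis
    qed
    have n3: "\<not> E x (h 2)"
    proof
      assume "E x (h 2)"
      moreover obtain g where "cycle_enum g k H" "g 0 = h 2"
        using cycle_enum_rotate[OF cyc(1) h2(2)] by metis
      ultimately show False
        using cycle_no_double_link[OF v H _ cyc(2) x(1) x'(1) ne(1)] ne(2) by metis
    qed
    have "x' \<notin> nb (h 0)" using ev(3) ne(1) st(4,5) unfolding nb0 by auto
    then have n4: "\<not> E (h 0) x'" using ev(4) unfolding nb_def by blast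
    have nv: "\<not> E v (h 0)" "\<not> E v (h 1)" "\<not> E v (h 2)" using na st h2 by blast+
    show False
    proof (cases "E x x'")
      case True
      then show False
        using no_C5[OF x(2) st(6) h12 x'(3) sym[OF True]] n1 n2 n3 n4 \<open>\<not> E (h 0) (h 2)\<close> sym_iff[of x' "h 1"]
        by simp
    next
      case False
      then show False
        using no_C6[OF xV(2) x(2) st(6) h12 x'(3) ev(2)] n1 n2 n3 n4 nv
          \<open>\<not> E (h 0) (h 2)\<close> sym_iff[of x' "h 1"]
        by simp
    qed
  next
    case True
    obtain x' where x': "x' \<in> links v H" "x' \<noteq> x"
    proof -
      have "\<not> links v H \<subseteq> {x}"
      proof
        assume "links v H \<subseteq> {x}"
        then have "card (links v H) \<le> 1" using card_mono[of "{x}"] by fastforce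
        then show False using two_links[OF v H] by simp
      qed
      then show thesis using that by blast
    qed
    then obtain y where y: "x' \<in> nb v" "y \<in> H" "E x' y" unfolding links_def by blast
    have x'K: "x' \<in> K" using toK y x' by blast
    have "x' \<notin> nb (h 0)" using na(5) x'(2) st(4,5) y(1) unfolding nb0 by auto
    then have y0: "y \<noteq> h 0" using y sym unfolding nb_def by blast
    have "y \<notin> h ` {2..k - 2}"
    proof
      assume "y \<in> h ` {2..k - 2}"
      then show False using badcD(5)[OF K(1) x'K _ y(3)] QT True by blast
    qed
    then have "E (h 0) y" using Q y(2) y0 st(1) by blast
    then obtain g where "cycle_enum g k H" "g 0 = h 0" "g 1 = y"
      using cycle_enum_start[OF cyc(1) st(3) y(2)] by metis
    then show False
      using cycle_no_adjacent_links[OF v H _ cyc(2) x(1) y(1) x'(2)[symmetric]] x(2) y(3) by metis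
  qed
qed

subsection \<open>Bad components of order three\<close>

lemma nb_not_adj: "nb u = S \<Longrightarrow> w \<in> V \<Longrightarrow> w \<notin> S \<Longrightarrow> \<not> E u w"
  unfolding nb_def by blast

text \<open>A shortest connection of \<open>x\<close> and \<open>y\<close> through \<open>H\<close>
  has at most three inner vertices. With two or three it would form an induced 5- or 6-cycle
  together with \<open>v\<close>, so there is a common neighbour \<open>a\<close>. The degree bound
  leaves \<open>a\<close> one neighbour in \<open>H\<close>, which makes \<open>H\<close> a
  path.\<close>

lemma linked_pair:
  assumes v: "v \<in> V" and H: "H \<in> badc (cnb v)"
    and x: "x \<in> links v H" "y \<in> links v H" "x \<noteq> y" "\<not> E x y"
  obtains a b c where "H = {a, b, c}" "distinct [a, b, c]" "nb a = {x, y, b}" "E b c"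
proof -
  note na = not_adj[OF H]
  have H3: "card H = 3" using badc_card_3[OF v H] .
  have cH: "conn H" using badcD(2)[OF H] .
  have xy: "x \<in> V" "y \<in> V" "E v x" "E y v" "x \<notin> H" "y \<notin> H"
    using x sym na unfolding links_def nb_def by blast+
  have "\<exists>a\<in>H. E a x \<and> E a y"
  proof (rule ccontr)
    assume nc: "\<not> ?thesis"
    obtain p q where pq: "p \<in> H" "E x p" "q \<in> H" "E q y"
      using x sym unfolding links_def by blast
    have n: "\<not> E x q" "\<not> E p y" "p \<noteq> q" using nc pq sym by blast+
    show False
    proof (cases "E p q")
      case True
      then show False using no_C5[OF xy(3) pq(2) True pq(4) xy(4)] x(4) n na(1)[OF pq(1)] na(1)[OF pq(3)] by blast
    next
      case False
      then obtain r where r: "r \<in> H" "E p r" "E r q"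
        using conn_three_adj[OF cH H3 pq(1,3) n(3)] by metis
      have "\<not> (E x r \<and> E r y)" using nc r sym by blast
      moreover have "\<not> E x r"
      proof
        assume "E x r"
        then show False using no_C5[OF xy(3) \<open>E x r\<close> r(3) pq(4) xy(4)] \<open>\<not> (E x r \<and> E r y)\<close> x(4) n
            na(1)[OF r(1)] na(1)[OF pq(3)] by blast
      qed
      moreover have "\<not> E r y"
      proof
        assume "E r y"
        then show False using no_C5[OF xy(3) pq(2) r(2) \<open>E r y\<close> xy(4)] \<open>\<not> E x r\<close> x(4) n
            na(1)[OF r(1)] na(1)[OF pq(1)] by blast
      qed
      ultimately show False
        using no_C6[OF xy(3) pq(2) r(2) r(3) pq(4) xy(4)] False x(4) n
          na(1)[OF r(1)] na(1)[OF pq(1)] na(1)[OF pq(3)] by blast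
    qed
  qed
  then obtain a where a: "a \<in> H" "E a x" "E a y" by blast
  obtain b where b: "b \<in> H" "E a b" using conn_nbr[OF cH a(1)] H3 by auto
  have bxy: "b \<noteq> x" "b \<noteq> y" "b \<noteq> a" "b \<in> V" "a \<in> V" using b a xy na irrefl by metis+
  have nba: "nb a = {x, y, b}"
    by (rule nb_full) (use a b xy bxy x(3) in \<open>auto simp: mem_nb\<close>)
  have fH: "finite H" using H3 card.infinite by fastforce
  have "card (H - {a, b}) = 1" using H3 fH a b bxy by (simp add: card_Diff_subset)
  then obtain c where c: "H - {a, b} = {c}" by (meson card_1_singletonE)
  have Heq: "H = {a, b, c}" "c \<noteq> a" "c \<noteq> b" "c \<in> H" using c a b by blast+
  obtain z where z: "z \<in> H" "E c z" using conn_nbr[OF cH Heq(4)] H3 by auto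
  have "c \<notin> nb a" using nba Heq(2-4) xy(5,6) by auto
  then have "z \<noteq> a" using z(2) sym na(4)[OF Heq(4)] unfolding nb_def by blast
  then have "z = b" using z Heq irrefl by blast
  then have "E b c" using z(2) sym by blast
  then show thesis using that[of a b c] Heq bxy nba by auto
qed

text \<open>\<open>K\<close> would be a cycle of order 7 or 11 with \<open>v\<close> between
  \<open>x2\<close> and \<open>x3\<close>. Two neighbours on \<open>K\<close> and one in
  \<open>H\<close> exhaust \<open>x2\<close>, so \<open>x1\<close> is not adjacent to it and
  \<open>linked_pair\<close> applies. A bad component of \<open>V - cnb a\<close> has order 3 and
  misses the long path \<open>K - {x2}\<close>; it can only be entered through \<open>b\<close>, at
  \<open>c\<close>, where it leaves \<open>c\<close> without a neighbour.\<close>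

lemma small_component_not_cycle:
  assumes v: "v \<in> V" and H: "H \<in> badc (cnb v)"
    and nbv: "nb v = {x1, x2, x3}" and ds: "distinct [x1, x2, x3]"
    and x1: "x1 \<in> links v H" and x2: "x2 \<in> links v H"
    and K: "K \<in> badc (insert x1 H)" "v \<in> K" "card K \<noteq> 3"
  shows False
proof -
  note na = not_adj[OF H]
  have cH: "conn H" using badcD(2)[OF H] .
  have HV: "H \<subseteq> V" using na(4) by blast
  have KV: "K \<subseteq> V" "K \<inter> H = {}" "x1 \<notin> K" using badcD(1)[OF K(1)] by blast+
  have xV: "x1 \<in> V" "x2 \<in> V" "x3 \<in> V" "E v x1" "E v x2" "E v x3" "x1 \<notin> H" "x2 \<notin> H" "x3 \<notin> H"
    using nbv na(5) unfolding nb_def by blast+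
  have x23: "x2 \<in> K" "x3 \<in> K" using badcD(5)[OF K(1,2)] xV ds by auto
  obtain k g where kg: "cycle_enum g k K" "k = 7 \<or> k = 11" "g 0 = v" "g 1 = x3"
  proof -
    obtain f where f: "cycle_enum f (card K) K" "card K = 7 \<or> card K = 11"
      using bad_cases[OF badcD(3)[OF K(1)] K(3)] by metis
    show thesis using cycle_enum_start[OF f(1) K(2) x23(2) xV(6)] f(2) that by metis
  qed
  note st = cycle_start_nbrs[OF kg(1)]
  have "x2 \<in> {w\<in>K. E (g 0) w}" using x23 xV kg(3) by simp
  then have gx2: "g (k - 1) = x2" using st(1) kg(4) ds by auto
  have lt: "0 \<le> k - 2" "k - 2 < k" using kg(2) by auto
  note seg = cycle_segment[OF kg(1) lt]
  have inj: "inj_on g {..<k}" and Kg: "K = g ` {..<k}" using kg(1) unfolding cycle_enum_def bij_betw_def by auto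
  have segK: "g ` {0..k - 2} = K - {x2}"
  proof -
    have "K - {x2} = g ` {..<k} - g ` {k - 1}" unfolding Kg gx2[symmetric] by simp
    also have "\<dots> = g ` ({..<k} - {k - 1})"
      by (rule inj_on_image_set_diff[OF inj, symmetric]) (use kg(2) in auto)
    also have "{..<k} - {k - 1} = {0..k - 2}" using kg(2) by auto
    finally show ?thesis by simp
  qed
  obtain t where t: "t \<in> H" "E x2 t" using x2 unfolding links_def by blast
  obtain p q where pq: "p \<noteq> q" "p \<in> K" "q \<in> K" "{w\<in>K. E x2 w} = {p, q}"
    using cycle_enum_two_nbrs[OF kg(1) x23(1)] by metis
  have "v \<in> {w\<in>K. E x2 w}" using K(2) xV sym by blast
  then obtain j where j: "j \<in> K" "E x2 j" "j \<noteq> v" using pq by auto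
  have nbx2: "nb x2 = {v, j, t}"
    by (rule nb_full) (use xV t j K(2) KV v HV sym in \<open>auto simp: mem_nb\<close>)
  have n12: "\<not> E x1 x2"
  proof
    assume "E x1 x2"
    then have "x1 \<in> {v, j, t}" using nb_not_adj[OF nbx2] xV(1) sym by blast
    then show False using j(1) t(1) KV(3) xV(7) K(2) by auto
  qed
  obtain a b c where abc: "H = {a, b, c}" "distinct [a, b, c]" "nb a = {x1, x2, b}" "E b c"
    using linked_pair[OF v H x1 x2 _ n12] ds by auto
  have aV: "a \<in> V" "b \<in> V" "c \<in> V" using HV abc(1) by auto
  have cnba: "cnb a = {a, x1, x2, b}" using abc(3) unfolding cnb_def by blast
  have "b \<noteq> x1" "b \<noteq> x2" using xV abc(1) by blast+
  then have "card (nb a) = 3" using abc(3) ds by simp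
  then obtain C where C: "C \<in> badc (cnb a)" using badc_nonempty[OF aV(1)] by auto
  have C3: "card C = 3" using badc_card_3[OF aV(1) C] .
  have clC: "closed_in (V - cnb a) C" using C unfolding badc_def is_component_def by blast
  have CV: "C \<subseteq> V" "a \<notin> C" "b \<notin> C" "x1 \<notin> C" "x2 \<notin> C" using badcD(1)[OF C] unfolding cnba by blast+
  have "K - {x2} \<subseteq> V - cnb a" using KV abc(1) unfolding cnba by blast
  have KC: "(K - {x2}) \<inter> C = {}"
  proof (rule ccontr)
    assume "(K - {x2}) \<inter> C \<noteq> {}"
    then have "K - {x2} \<subseteq> C"
      using conn_subset_closed[OF seg(1) _ clC] \<open>K - {x2} \<subseteq> V - cnb a\<close> unfolding segK by blast
    then have "card (K - {x2}) \<le> 3" using C3 card_mono[OF bad_finite[OF badcD(3)[OF C]]] by metis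
    then show False using seg(2) kg(2) unfolding segK by auto
  qed
  have fromH: "w \<in> H" if "u \<in> H" "w \<in> C" "E u w" for u w
  proof -
    have "w \<in> H \<or> w \<in> nb v" using badc_nbr[OF H that(1) _ that(3)] that(2) CV by blast
    moreover have "w \<notin> nb v" using nbv that(2) CV KC x23 ds by auto
    ultimately show ?thesis by blast
  qed
  have nx2: "\<not> E x2 w" if "w \<in> C" for w
  proof
    assume "E x2 w"
    then have "w \<in> {v, j, t}" using nb_not_adj[OF nbx2] that CV by blast
    moreover have "v \<noteq> x2" "j \<noteq> x2" using xV(5) j(2) irrefl by metis+
    then have "w \<noteq> v" "w \<noteq> j" using K(2) j(1) KC that by blast+
    moreover have "a \<in> {v, j, t}" using nb_not_adj[OF nbx2 aV(1)] abc(3) sym unfolding nb_def by blast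
    then have "a = t" using j(1) K(2) KV(2) abc(1) by auto
    ultimately show False using that CV by blast
  qed
  \<comment> \<open>\<open>x2\<close> has no neighbour in \<open>C\<close>, and \<open>x1\<close>
    alone would be a single link.\<close>
  have "b \<in> links a C"
  proof (rule ccontr)
    assume "b \<notin> links a C"
    then have "links a C \<subseteq> {x1}" using abc(3) nx2 unfolding links_def by blast
    then have "card (links a C) \<le> 1" using card_mono[of "{x1}"] by fastforce
    then show False using two_links[OF aV(1) C] by simp
  qed
  then obtain y where y: "y \<in> C" "E b y" unfolding links_def by blast
  then have "y \<in> H" using fromH abc(1) by blast
  then have cC: "c \<in> C" using y abc(1) CV by blast
  obtain z where z: "z \<in> C" "E c z" using conn_nbr[OF badcD(2)[OF C] cC] C3 by auto
  then have "z \<in> H" using fromH abc(1) by blast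
  then show False using z abc(1) CV irrefl by blast
qed

text \<open>A bad component of \<open>V - cnb a\<close> has order 3. Inside \<open>R\<close> it
  would be cut off by \<open>x\<close>, so only \<open>v\<close>, \<open>z\<close> and
  \<open>c\<close> remain for it; there \<open>c\<close>, not adjacent to \<open>v\<close>, needs
  \<open>z\<close> as a neighbour.\<close>

lemma small_pair_component:
  assumes v: "v \<in> V" and H: "H \<in> badc (cnb v)"
    and nbv: "nb v = {x, y, z}" and ds: "distinct [x, y, z]"
    and abc: "H = {a, b, c}" "distinct [a, b, c]" "nb a = {x, y, b}"
    and R: "\<And>u w. u \<in> R \<Longrightarrow> w \<in> V \<Longrightarrow> E u w \<Longrightarrow> w \<in> R \<or> w = x"
    and VR: "V = {v, x, y, z} \<union> H \<union> R" and Rd: "R \<inter> ({v, x, y, z} \<union> H) = {}"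
  shows "E c z"
proof -
  note na = not_adj[OF H]
  have HV: "H \<subseteq> V" using na(4) by blast
  have xV: "x \<in> V" "y \<in> V" "z \<in> V" "x \<notin> H" "y \<notin> H" "z \<notin> H"
    using nbv na(5) unfolding nb_def by blast+
  have aV: "a \<in> V" "b \<in> V" "c \<in> V" using HV abc(1) by auto
  have cnba: "cnb a = {a, x, y, b}" using abc(3) unfolding cnb_def by blast
  have "b \<noteq> x" "b \<noteq> y" using xV abc(1) by blast+
  then have "card (nb a) = 3" using abc(3) ds by simp
  then obtain C where C: "C \<in> badc (cnb a)" using badc_nonempty[OF aV(1)] by auto
  have C3: "card C = 3" using badc_card_3[OF aV(1) C] .
  have CV: "C \<subseteq> V" "a \<notin> C" "b \<notin> C" "x \<notin> C" "y \<notin> C" using badcD(1)[OF C] unfolding cnba by blast+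
  have "C \<inter> R = {}"
  proof (rule ccontr)
    assume ne: "C \<inter> R \<noteq> {}"
    have "closed_in C (C \<inter> R)" using R CV unfolding closed_in_def by blast
    then have "C \<subseteq> R" using badcD(2)[OF C] ne unfolding conn_def by blast
    show False
    proof (rule no_cut_vertex[of C x])
      show "bad C" "conn C" using badcD[OF C] by blast+
      show "C \<subseteq> V" "x \<in> V" "x \<notin> C" by fact+
      fix u w assume uw: "u \<in> C" "w \<in> V" "E u w"
      then have "w \<in> R \<or> w = x" using R \<open>C \<subseteq> R\<close> by blast
      moreover have "w \<in> C \<or> w \<in> cnb a" using badcD(5)[OF C uw] by blast
      moreover have "\<not> (w \<in> R \<and> w \<in> {a, y, b})" using Rd abc(1) by blast
      ultimately show "w \<in> C \<or> w = x" unfolding cnba by blast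
    qed
  qed
  then have "C \<subseteq> {v, z, c}" using CV VR abc(1) by blast
  moreover have "card {v, z, c} \<le> 3" by (simp add: card_insert_if)
  ultimately have Ceq: "C = {v, z, c}" using C3 card_seteq[of "{v, z, c}" C] by simp
  have "c \<in> H" using abc(1) by blast
  obtain w where w: "w \<in> C" "E c w" using conn_nbr[OF badcD(2)[OF C], of c] C3 Ceq by auto
  have "w \<noteq> v" using w(2) na(2)[OF \<open>c \<in> H\<close>] by blast
  then show ?thesis using w Ceq irrefl by blast
qed

text \<open>The triangle \<open>v\<close>, \<open>x\<close>, \<open>z\<close> completes the
  neighbourhoods of \<open>x\<close> and \<open>z\<close>. The forbidden cycles then exclude
  \<open>E y b\<close> and force \<open>E y c\<close>. What remains outside \<open>cnb y\<close> is
  \<open>x\<close>, \<open>z\<close>, \<open>b\<close>; it would have to be a bad component, but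
  \<open>b\<close> is isolated in it.\<close>

lemma seven_vertices_triangle:
  assumes V: "V = {v, x, y, z, a, b, c}" and ds: "distinct [v, x, y, z, a, b, c]"
    and nbv: "nb v = {x, y, z}" and nba: "nb a = {x, y, b}" and e: "E b c" "E c z" "\<not> E x y" "E z x"
  shows False
proof -
  have inV: "v \<in> V" "x \<in> V" "y \<in> V" "z \<in> V" "a \<in> V" "b \<in> V" "c \<in> V" unfolding V by blast+
  have ev: "E v x" "E v y" "E v z" "E a x" "E a y" "E a b"
    using nbv nba unfolding nb_def by blast+
  have nv: "\<not> E v a" "\<not> E v b" "\<not> E v c" "\<not> E a c" "\<not> E a z"
    using nb_not_adj[OF nbv] nb_not_adj[OF nba] inV ds by auto
  have nbz: "nb z = {v, c, x}"
    by (rule nb_full) (use inV ds ev e sym in \<open>auto simp: mem_nb\<close>)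
  have nbx: "nb x = {v, a, z}"
    by (rule nb_full) (use inV ds ev e sym in \<open>auto simp: mem_nb\<close>)
  have nz': "\<not> E z y" "\<not> E z b" "\<not> E x b"
    using nb_not_adj[OF nbz inV(3)] nb_not_adj[OF nbz inV(6)] nb_not_adj[OF nbx inV(6)] ds by auto
  then have nz: "\<not> E y z" "\<not> E b z" using sym by blast+
  have "\<not> E y b"
  proof
    assume yb: "E y b"
    have nby: "nb y = {v, a, b}"
      by (rule nb_full) (use inV ds ev e yb sym in \<open>auto simp: mem_nb\<close>)
    then have "\<not> E y c" using nb_not_adj inV ds by auto
    then show False using no_C5[OF ev(2) yb e(1,2) sym[OF ev(3)]] nv nz by blast
  qed
  then have yc: "E y c"
    using no_C6[OF ev(2) sym[OF ev(5)] ev(6) e(1,2) sym[OF ev(3)]] nv nz by blast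
  have nby: "nb y = {v, a, c}"
    by (rule nb_full) (use inV ds ev yc sym in \<open>auto simp: mem_nb\<close>)
  then have "card (nb y) = 3" using ds by simp
  then obtain C where C: "C \<in> badc (cnb y)" using badc_nonempty[OF inV(3)] by auto
  have C3: "card C = 3" using badc_card_3[OF inV(3) C] .
  have "C \<subseteq> {x, z, b}" using badcD(1)[OF C] V nby unfolding cnb_def by blast
  moreover have "card {x, z, b} = 3" using ds by simp
  ultimately have Ceq: "C = {x, z, b}" using C3 card_seteq[of "{x, z, b}" C] by simp
  obtain w where "w \<in> C" "E b w" using conn_nbr[OF badcD(2)[OF C], of b] C3 Ceq by auto
  then show False using Ceq nz nz' sym irrefl by blast
qed

text \<open>By \<open>seven_vertices_triangle\<close>, used for \<open>x\<close> and by symmetry for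
  \<open>y\<close>, neither is adjacent to \<open>z\<close>. The forbidden cycles then force both to
  be adjacent to \<open>c\<close>, whose degree becomes 4.\<close>

lemma seven_vertices:
  assumes V: "V = {v, x, y, z, a, b, c}" and ds: "distinct [v, x, y, z, a, b, c]"
    and nbv: "nb v = {x, y, z}" and nba: "nb a = {x, y, b}" and e: "E b c" "E c z" "\<not> E x y"
  shows False
proof -
  have inV: "v \<in> V" "x \<in> V" "y \<in> V" "z \<in> V" "a \<in> V" "b \<in> V" "c \<in> V" unfolding V by blast+
  have ev: "E v x" "E v y" "E v z" "E a x" "E a y" "E a b"
    using nbv nba unfolding nb_def by blast+
  have nv: "\<not> E v a" "\<not> E v b" "\<not> E v c" "\<not> E a c" "\<not> E a z"
    using nb_not_adj[OF nbv] nb_not_adj[OF nba] inV ds by auto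
  have zx: "\<not> E x z"
    using seven_vertices_triangle[OF assms] sym by blast
  have zy: "\<not> E y z"
    using seven_vertices_triangle[of v y x z a b c] V ds nbv nba e sym by (auto simp: insert_commute)
  have zb: "\<not> E b z"
  proof
    assume bz: "E b z"
    have nbb: "nb b = {a, c, z}"
      by (rule nb_full) (use inV ds ev e bz sym in \<open>auto simp: mem_nb\<close>)
    then have "\<not> E x b" using nb_not_adj[OF nbb, of x] sym inV ds by auto
    then show False
      using no_C5[OF ev(1) sym[OF ev(4)] ev(6) bz sym[OF ev(3)]] nv zx by blast
  qed
  \<comment> \<open>Otherwise \<open>v\<close>, \<open>u\<close>, \<open>b\<close>,
    \<open>c\<close>, \<open>z\<close> is an induced 5-cycle or, if \<open>u\<close> is not adjacent
    to \<open>b\<close>, the detour through \<open>a\<close> gives an induced 6-cycle.\<close>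
  have toc: "E u c" if u: "u \<in> {x, y}" for u
  proof (rule ccontr)
    assume uc: "\<not> E u c"
    have eu: "E v u" "E a u" "\<not> E u z" using u ev zx zy by blast+
    show False
    proof (cases "E u b")
      case True
      then show False using no_C5[OF eu(1) True e(1,2) sym[OF ev(3)]] nv eu uc zb by blast
    next
      case False
      then show False
        using no_C6[OF eu(1) sym[OF eu(2)] ev(6) e(1,2) sym[OF ev(3)]] nv eu uc zb by blast
    qed
  qed
  have "{b, z, x, y} \<subseteq> nb c" using toc e inV sym unfolding nb_def by blast
  then have "card {b, z, x, y} \<le> 3" using card_mono[OF fin_nb] deg_le_3[OF inV(7)] by (meson le_trans)
  then show False using ds by auto
qed

text \<open>The component \<open>K\<close> has shrunk to \<open>{v, x2, x3}\<close>, so any further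
  vertex is attached through \<open>x1\<close> alone. If there is one, the neighbourhood of
  \<open>x1\<close> is full and an induced 5- or 6-cycle through \<open>x3\<close> and
  \<open>H\<close> appears. Otherwise there are 7 vertices; \<open>seven_vertices\<close> makes
  linked neighbours of \<open>v\<close> pairwise adjacent, so only \<open>x1\<close> and
  \<open>x2\<close> are linked, and the bad component left by \<open>cnb x1\<close> would contain
  \<open>x3\<close> as an isolated vertex.\<close>

lemma no_cubic_vertex:
  assumes v: "v \<in> V" and d: "3 \<le> card (nb v)"
  shows False
proof -
  obtain H where H: "H \<in> badc (cnb v)" using badc_nonempty[OF v d] .
  note na = not_adj[OF H]
  have H3: "card H = 3" using badc_card_3[OF v H] .
  have HV: "H \<subseteq> V" using na(4) by blast
  obtain x1 K where x1: "x1 \<in> links v H" and K: "K \<in> badc (insert x1 H)" "v \<in> K"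
    using small_component[OF v H H3] by metis
  have d3: "card (nb v) = 3" using d deg_le_3[OF v] by simp
  obtain x2 where x2: "x2 \<in> links v H" "x2 \<noteq> x1"
  proof -
    have "\<not> links v H \<subseteq> {x1}"
    proof
      assume "links v H \<subseteq> {x1}"
      then have "card (links v H) \<le> 1" using card_mono[of "{x1}"] by fastforce
      then show False using two_links[OF v H] by simp
    qed
    then show thesis using that by blast
  qed
  have x12: "x1 \<in> nb v" "x2 \<in> nb v" using x1 x2 unfolding links_def by blast+
  have "card (nb v - {x1, x2}) = 1" using d3 x12 x2(2) by (simp add: card_Diff_subset)
  then obtain x3 where "nb v - {x1, x2} = {x3}" by (meson card_1_singletonE)
  then have nbv: "nb v = {x1, x2, x3}" and ds: "distinct [x1, x2, x3]" using x12 x2(2) by auto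
  have K3: "card K = 3" using small_component_not_cycle[OF v H nbv ds x1 x2(1) K] by blast
  have xV: "x1 \<in> V" "x2 \<in> V" "x3 \<in> V" "E v x1" "E v x2" "E v x3" "x1 \<notin> H" "x2 \<notin> H" "x3 \<notin> H"
    using nbv na(5) unfolding nb_def by blast+
  have vn: "v \<notin> H" "v \<noteq> x1" "v \<noteq> x2" "v \<noteq> x3" using na xV irrefl by metis+
  have "{v, x2, x3} \<subseteq> K" using badcD(5)[OF K] K(2) xV ds by auto
  moreover have "card {v, x2, x3} = 3" using vn ds by simp
  ultimately have Keq: "K = {v, x2, x3}"
    using card_seteq[of K "{v, x2, x3}"] K3 bad_finite[OF badcD(3)[OF K(1)]] by simp
  define R where "R = V - ({v, x1, x2, x3} \<union> H)"
  have VR: "V = {v, x1, x2, x3} \<union> H \<union> R" using v xV HV unfolding R_def by blast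
  have Rd: "R \<inter> ({v, x1, x2, x3} \<union> H) = {}" unfolding R_def by blast
  \<comment> \<open>\<open>K\<close> is a component once \<open>x1\<close> and \<open>H\<close> are
    deleted, and \<open>H\<close> is attached only to \<open>nb v\<close>; hence no edge joins
    \<open>R\<close> to \<open>K\<close> or to \<open>H\<close>.\<close>
  have R: "w \<in> R \<or> w = x1" if u: "u \<in> R" "w \<in> V" "E u w" for u w
  proof (rule ccontr)
    assume "\<not> ?thesis"
    then have "w \<in> K \<or> w \<in> H" using u(2) VR Keq by blast
    moreover have "u \<in> V" "E w u" using u sym unfolding R_def by blast+
    ultimately have "u \<in> K \<or> u \<in> insert x1 H \<or> u \<in> H \<or> u \<in> nb v"
      using badcD(5)[OF K(1)] badc_nbr[OF H] by blast
    then show False using u(1) Rd Keq nbv by blast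
  qed
  obtain h where h: "h \<in> H" "E x1 h" using x1 unfolding links_def by blast
  show False
  proof (cases "R = {}")
    case False
    have "\<exists>j\<in>R. E x1 j"
    proof (rule ccontr)
      assume "\<not> ?thesis"
      then have "closed_in V R" using R sym unfolding closed_in_def R_def by blast
      then have "R = V" using con False unfolding conn_def by blast
      then show False using v Rd by blast
    qed
    then obtain j where j: "j \<in> R" "E x1 j" by blast
    have jV: "j \<in> V" "j \<noteq> v" "j \<noteq> h" "h \<in> V" "h \<noteq> v" using j h HV vn unfolding R_def by blast+
    have nbx1: "nb x1 = {v, h, j}"
      by (rule nb_full) (use jV j h v xV sym in \<open>auto simp: mem_nb\<close>)
    have "x2 \<notin> {v, h, j}" "x3 \<notin> {v, h, j}" using xV(8,9) vn h(1) j(1) Rd by auto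
    then have notx1: "\<not> E x1 x2" "\<not> E x1 x3" using nb_not_adj[OF nbx1] xV(2,3) by blast+
    obtain a b c where abc: "H = {a, b, c}" "distinct [a, b, c]" "nb a = {x1, x2, b}" "E b c"
      using linked_pair[OF v H x1 x2(1) x2(2)[symmetric] notx1(1)] by metis
    have cz: "E c x3" by (rule small_pair_component[OF v H nbv ds abc(1-3) R VR Rd])
    have abcV: "a \<in> V" "b \<in> V" "c \<in> V" using HV abc(1) by auto
    have "E a x1" using abc(3) unfolding nb_def by blast
    then have "a \<in> {v, h, j}" using nb_not_adj[OF nbx1 abcV(1)] sym by blast
    moreover have "a \<noteq> v" "a \<noteq> j" using vn(1) abc(1) j(1) Rd by auto
    ultimately have "h = a" by blast
    then have nx: "\<not> E x1 b" "\<not> E x1 c"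
      using nb_not_adj[OF nbx1] abcV abc(1,2) vn(1) j(1) Rd by auto
    have ea: "E a x1" "E a b" using abc(3) unfolding nb_def by blast+
    have na3: "\<not> E x3 a" "\<not> E c a"
      using nb_not_adj[OF abc(3)] abc(1,2) xV ds abcV sym by auto
    have nvH: "\<not> E v a" "\<not> E v b" "\<not> E v c" using na(1) abc(1) by blast+
    show False
    proof (cases "E x3 b")
      case True
      then show False
        using no_C5[OF sym[OF xV(4)] xV(6) True sym[OF ea(2)] ea(1)] notx1 nx na3 nvH by blast
    next
      case False
      then show False
        using no_C6[OF sym[OF xV(4)] xV(6) sym[OF cz] sym[OF abc(4)] sym[OF ea(2)] ea(1)]
          notx1 nx na3 nvH by blast
    qed
  next
    case True
    have V7: "V = {v, x1, x2, x3} \<union> H" using VR True by blast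
    \<comment> \<open>Stated for any naming of the three neighbours, as it serves both the pair
      \<open>x1\<close>, \<open>x2\<close> and the pair \<open>x1\<close>,
      \<open>x3\<close>.\<close>
    have nonadj: False if xyz: "nb v = {x, y, z}" "distinct [x, y, z]"
      "x \<in> links v H" "y \<in> links v H" "\<not> E x y" for x y z
    proof -
      have "x \<noteq> y" using xyz(2) by simp
      then obtain a b c where abc: "H = {a, b, c}" "distinct [a, b, c]" "nb a = {x, y, b}" "E b c"
        using linked_pair[OF v H xyz(3,4) _ xyz(5)] by metis
      have V': "V = {v, x, y, z} \<union> H \<union> {}" using V7 nbv xyz(1) by blast
      have cz: "E c z" using small_pair_component[OF v H xyz(1,2) abc(1-3) _ V'] by blast
      have xs: "x \<in> nb v" "y \<in> nb v" "z \<in> nb v" unfolding xyz(1) by simp_all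
      have vv: "v \<notin> nb v" by (simp add: nb_def)
      show False
      proof (rule seven_vertices[of v x y z a b c])
        show "V = {v, x, y, z, a, b, c}" using V' abc(1) by auto
        have "{x, y, z} \<inter> {a, b, c} = {}" using na(5) xs abc(1) by blast
        moreover have "v \<notin> {x, y, z}" using vv unfolding xyz(1) .
        ultimately show "distinct [v, x, y, z, a, b, c]" using xyz(2) abc(1,2) vn(1) by auto
      qed (use xyz abc cz in auto)
    qed
    have e12: "E x1 x2" using nonadj[OF nbv ds x1 x2(1)] by blast
    have x3n: "x3 \<notin> links v H"
    proof
      assume x3: "x3 \<in> links v H"
      have "E x1 x3" using nonadj[of x1 x3 x2] nbv ds x1 x3 by auto
      then have "{v, x2, x3, h} \<subseteq> nb x1" using h e12 HV xV v sym unfolding nb_def by blast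
      then have "card {v, x2, x3, h} \<le> 3" using card_mono[OF fin_nb] deg_le_3[OF xV(1)] by (meson le_trans)
      moreover have "distinct [v, x2, x3, h]" using vn ds h(1) xV by auto
      ultimately show False by auto
    qed
    obtain h2 where h2: "h2 \<in> H" "E x2 h2" using x2 unfolding links_def by blast
    have nbx1: "nb x1 = {v, x2, h}"
      by (rule nb_full) (use v vn xV ds h HV e12 sym in \<open>auto simp: mem_nb\<close>)
    have nbx2: "nb x2 = {v, x1, h2}"
      by (rule nb_full) (use v vn xV ds h2 HV e12 sym in \<open>auto simp: mem_nb\<close>)
    have "v \<noteq> x2" "v \<noteq> h" "x2 \<noteq> h" using vn(1,3) h(1) xV(8) by auto
    then have "card (nb x1) = 3" unfolding nbx1 by simp
    then obtain C where C: "C \<in> badc (cnb x1)" using badc_nonempty[OF xV(1)] by auto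
    have C3: "card C = 3" using badc_card_3[OF xV(1) C] .
    have Csub: "C \<subseteq> insert x3 (H - {h})" using badcD(1)[OF C] V7 nbx1 unfolding cnb_def by blast
    moreover have fH: "finite H" using H3 card.infinite by fastforce
    moreover have "card (insert x3 (H - {h})) \<le> 3" using H3 h fH by (simp add: card_insert_if)
    ultimately have "C = insert x3 (H - {h})" using C3 card_seteq[of "insert x3 (H - {h})" C] by simp
    then obtain w where w: "w \<in> C" "E x3 w" using conn_nbr[OF badcD(2)[OF C], of x3] C3 by auto
    then have "w \<in> H" using Csub irrefl by blast
    then show False using x3n w(2) nbv unfolding links_def by blast
  qed
qed

text \<open>The exceptions arise here. With order n, \<open>4 * ((n + 2) div 5)\<close> exceeds n
  only for n = 3, and among n \<ge> 3 \<open>4 * ((n + 4) div 5)\<close> exceeds n only for 3, 6, 7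
  and 11. A cycle of order 6 is itself a forbidden induced cycle; the other cases are
  \<open>bad\<close>.\<close>

theorem contradiction: False
proof -
  have "card (nb v) \<le> 2" if "v \<in> V" for v
    using no_cubic_vertex[OF that] by force
  then consider h where "path_enum h (card V) V" | h where "cycle_enum h (card V) V"
    using deg2_enum[OF fin con] unfolding nb_def by blast
  then show False
  proof cases
    case 1
    obtain D where D: "isolating V D" "card D \<le> (card V + 2) div 5" using path_isolating[OF 1] by blast
    have "card V \<noteq> 3" using nbad unfolding bad_def by blast
    then have "4 * ((card V + 2) div 5) \<le> card V" by presburger
    then have "4 * card D \<le> card V" using D(2) by linarith
    then show False using ngood D(1) unfolding good_def by blast
  next
    case 2
    obtain D where D: "isolating V D" "card D \<le> (card V + 4) div 5" using cycle_isolating[OF 2] by blast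
    have n: "card V \<noteq> 3" "card V \<noteq> 7" "card V \<noteq> 11" using nbad 2 unfolding bad_def by metis+
    have n6: "card V \<noteq> 6"
    proof
      assume "card V = 6"
      then have adj: "E (h i) (h j) \<longleftrightarrow> j = (i + 1) mod 6 \<or> i = (j + 1) mod 6" if "i < 6" "j < 6" for i j
        using 2 that unfolding cycle_enum_def by metis
      show False
        using no_C6[of "h 0" "h 1" "h 2" "h 3" "h 4" "h 5"] by (simp add: adj)
    qed
    have "3 \<le> card V" using 2 unfolding cycle_enum_def by blast
    then have "16 \<le> card V \<or> card V \<in> {4, 5, 8, 9, 10, 12, 13, 14, 15}"
      using n n6 unfolding insert_iff empty_iff by presburger
    then have "4 * ((card V + 4) div 5) \<le> card V" by (elim disjE) (linarith, auto)
    then have "4 * card D \<le> card V" using D(2) by linarith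
    then show False using ngood D(1) unfolding good_def by blast
  qed
qed

end

text \<open>The induction runs over vertex sets with \<open>E\<close> fixed. The cycle conditions
  speak of \<open>E\<close> alone, so all subsets inherit them.\<close>

lemma (in ugraph) bad_or_good:
  assumes C5: "\<And>a b c d e. E a b \<Longrightarrow> E b c \<Longrightarrow> E c d \<Longrightarrow> E d e \<Longrightarrow> E e a \<Longrightarrow>
      E a c \<or> E a d \<or> E b d \<or> E b e \<or> E c e"
    and C6: "\<And>a b c d e f. E a b \<Longrightarrow> E b c \<Longrightarrow> E c d \<Longrightarrow> E d e \<Longrightarrow> E e f \<Longrightarrow> E f a \<Longrightarrow>
      E a c \<or> E a d \<or> E a e \<or> E b d \<or> E b e \<or> E b f \<or> E c e \<or> E c f \<or> E d f"
    and "finite V" "conn V"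
  shows "bad V \<or> good V"
  using assms(3,4)
proof (induction V rule: finite_psubset_induct)
  case (psubset V)
  show ?case
  proof (rule ccontr)
    assume no: "\<not> ?thesis"
    interpret min_counterexample E V
    proof unfold_locales
      show "finite V" "conn V" by fact+
      show "\<not> bad V" "\<not> good V" using no by blast+
      show "bad C \<or> good C" if "C \<subset> V" "conn C" for C using psubset.IH that by blast
    qed (fact C5 C6)+
    show False by (rule contradiction)
  qed
qed

subsection \<open>Transfer to digraphs\<close>

context graph
begin

sublocale ugraph "dominates G"
proof
  show "x \<rightarrow>\<^bsub>G\<^esub> y \<Longrightarrow> y \<rightarrow>\<^bsub>G\<^esub> x" for x y
    using sym_arcs unfolding symmetric_def by (blast elim: symE)
  show "\<not> x \<rightarrow>\<^bsub>G\<^esub> x" for x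
    using no_loops unfolding arcs_ends_def arc_to_ends_def by auto
qed

text \<open>The inverse \<open>g\<close> of the enumeration relabels the vertices, and each arc
  becomes the pair of its relabelled ends; this is injective on arcs because there are no parallel
  ones.\<close>

lemma enum_digraph_iso:
  assumes h: "bij_betw h {..<n} S" and "S \<subseteq> verts G"
    and adj: "\<forall>i<n. \<forall>j<n. h i \<rightarrow>\<^bsub>G\<^esub> h j \<longleftrightarrow> P i j"
  shows "digraph_iso (G \<restriction> S) (with_proj \<lparr>pverts = {..<n}, parcs = {(i, j). i < n \<and> j < n \<and> P i j}\<rparr>)"
proof -
  define g where "g = the_inv_into {..<n} h"
  have gh: "g (h i) = i" if "i < n" for i
    unfolding g_def using h that by (simp add: bij_betw_def the_inv_into_f_f)
  have hg: "g x < n" "h (g x) = x" if "x \<in> S" for x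
    using h that gh unfolding bij_betw_def by auto
  define f where "f = \<lparr>iso_verts = g, iso_arcs = \<lambda>e. (g (tail G e), g (head G e)),
    iso_head = snd, iso_tail = fst\<rparr>"
  have inj: "inj_on g S" by (rule inj_on_inverseI[of _ h]) (rule hg)
  have inj2: "inj_on (\<lambda>e. (g (tail G e), g (head G e))) (arcs (G \<restriction> S))"
  proof (rule inj_onI)
    fix e e' assume a: "e \<in> arcs (G \<restriction> S)" "e' \<in> arcs (G \<restriction> S)"
      "(g (tail G e), g (head G e)) = (g (tail G e'), g (head G e'))"
    then have "tail G e = tail G e'" "head G e = head G e'" using inj by (auto dest: inj_onD)
    then show "e = e'" using a no_multi_arcs by (auto simp: arc_to_ends_def)
  qed
  have iso: "pre_digraph.digraph_isomorphism (G \<restriction> S) f"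
    unfolding pre_digraph.digraph_isomorphism_def f_def using inj inj2 wellformed_induce_subgraph
    by auto
  have "(\<lambda>e. (g (tail G e), g (head G e))) ` arcs (G \<restriction> S) = {(i, j). i < n \<and> j < n \<and> P i j}"
  proof (intro equalityI subsetI)
    fix p assume "p \<in> (\<lambda>e. (g (tail G e), g (head G e))) ` arcs (G \<restriction> S)"
    then obtain e where e: "p = (g (tail G e), g (head G e))" "e \<in> arcs G" "tail G e \<in> S" "head G e \<in> S"
      by auto
    then have "h (g (tail G e)) \<rightarrow>\<^bsub>G\<^esub> h (g (head G e))"
      using hg in_arcs_imp_in_arcs_ends by metis
    then have "P (g (tail G e)) (g (head G e))" using adj hg(1) e(3,4) by blast
    then show "p \<in> {(i, j). i < n \<and> j < n \<and> P i j}" using hg(1) e by blast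
  next
    fix p assume "p \<in> {(i, j). i < n \<and> j < n \<and> P i j}"
    then obtain i j where ij: "p = (i, j)" "i < n" "j < n" "P i j" by blast
    then have "h i \<rightarrow>\<^bsub>G\<^esub> h j" using adj by blast
    then obtain e where "e \<in> arcs G" "tail G e = h i" "head G e = h j"
      unfolding arcs_ends_def arc_to_ends_def by auto
    moreover have "h i \<in> S" "h j \<in> S" using h ij unfolding bij_betw_def by auto
    ultimately show "p \<in> (\<lambda>e. (g (tail G e), g (head G e))) ` arcs (G \<restriction> S)"
      using gh ij by (intro image_eqI[of _ _ e]) auto
  qed
  moreover have "g ` S = {..<n}" using h gh hg unfolding bij_betw_def by force
  ultimately have "app_iso f (G \<restriction> S) = with_proj \<lparr>pverts = {..<n}, parcs = {(i, j). i < n \<and> j < n \<and> P i j}\<rparr>"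
    unfolding app_iso_def f_def with_proj_def by simp
  then show ?thesis using iso unfolding digraph_iso_def by metis
qed

lemma cycle_enum_iso: "cycle_enum h n S \<Longrightarrow> S \<subseteq> verts G \<Longrightarrow> digraph_iso (G \<restriction> S) (cycle_graph n)"
  unfolding cycle_enum_def cycle_graph_def by (intro enum_digraph_iso) blast+

lemma path_enum_iso: "path_enum h n S \<Longrightarrow> S \<subseteq> verts G \<Longrightarrow> digraph_iso (G \<restriction> S) (path_graph n)"
  unfolding path_enum_def path_graph_def by (intro enum_digraph_iso) blast+

lemma induce_verts: "G \<restriction> verts G = G"
  by (rule pre_digraph.equality) auto

lemma contains_induced_cycle:
  assumes "cycle_enum h n S" "S \<subseteq> verts G"
  shows "contains_induced G (cycle_graph n)"
  using cycle_enum_iso[OF assms] induced_induce[OF assms(2)] unfolding contains_induced_def by blast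

text \<open>In a symmetric digraph connectivity means that all vertices reach each other, and a
  closed set is never left along a walk.\<close>

lemma connected_conn:
  assumes "connected G"
  shows "conn (verts G)"
  unfolding conn_def
proof (intro conjI allI impI)
  have sc: "verts G \<noteq> {}" "\<And>u v. u \<in> verts G \<Longrightarrow> v \<in> verts G \<Longrightarrow> u \<rightarrow>\<^sup>*\<^bsub>G\<^esub> v"
    using assms reachable_mk_symmetric_eq[OF sym_arcs]
    unfolding connected_def strongly_connected_def by auto
  show "verts G \<noteq> {}" by (rule sc)
  fix A assume A: "closed_in (verts G) A" "A \<noteq> {}"
  obtain u where u: "u \<in> A" "u \<in> verts G" using A unfolding closed_in_def by blast
  have "w \<in> A" if "w \<in> verts G" for w
    using sc(2)[OF u(2) that]
  proof (induction rule: reachable_induct)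
    case base then show ?case using u by blast
  next
    case (step x y)
    moreover have "y \<in> verts G" using step by (simp add: adj_in_verts)
    ultimately show ?case using A unfolding closed_in_def by blast
  qed
  then show "A = verts G" using A unfolding closed_in_def by blast
qed

text \<open>Without parallel arcs distinct arcs leaving \<open>u\<close> have distinct heads, so
  uniqueness of the neighbour bounds the out-degree.\<close>

lemma isolating_one_isolating:
  assumes "isolating (verts G) D"
  shows "one_isolating_set G D"
proof -
  have D: "D \<subseteq> verts G" using assms unfolding isolating_def by blast
  define S where "S = verts G - nbhd D"
  have S: "verts G - closed_nbhd G D = S" unfolding S_def closed_nbhd_def nbhd_def by blast
  have "out_degree (G \<restriction> S) u \<le> 1" if u: "u \<in> S" for u
  proof -
    have "e = e'" if "e \<in> out_arcs (G \<restriction> S) u" "e' \<in> out_arcs (G \<restriction> S) u" for e e'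
    proof -
      have e: "e \<in> arcs G" "tail G e = u" "head G e \<in> S" "e' \<in> arcs G" "tail G e' = u" "head G e' \<in> S"
        using that by (auto simp: out_arcs_def)
      have "u \<rightarrow>\<^bsub>G\<^esub> head G e" "u \<rightarrow>\<^bsub>G\<^esub> head G e'"
        using in_arcs_imp_in_arcs_ends e by metis+
      then have "head G e = head G e'"
        using assms u e unfolding isolating_def S_def by blast
      then show ?thesis using no_multi_arcs e by (auto simp: arc_to_ends_def)
    qed
    moreover have "finite (out_arcs (G \<restriction> S) u)"
      by (rule finite_subset[OF _ finite_arcs]) (auto simp: out_arcs_def)
    ultimately show ?thesis unfolding out_degree_def by (auto simp: card_le_Suc0_iff_eq)
  qed
  moreover have "finite S" unfolding S_def by simp
  ultimately have "max_degree (delete_verts G (closed_nbhd G D)) \<le> 1"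
    unfolding max_degree_def delete_verts_def S by simp
  then show ?thesis using D unfolding one_isolating_set_def by blast
qed

lemma one_isolation_number_le:
  assumes "one_isolating_set G D"
  shows "one_isolation_number G \<le> card D"
proof -
  have "{D. one_isolating_set G D} \<subseteq> Pow (verts G)" unfolding one_isolating_set_def by blast
  then have "finite {D. one_isolating_set G D}" by (rule finite_subset) simp
  then show ?thesis unfolding one_isolation_number_def using assms by (intro Min_le) auto
qed

end

theorem theorem1p7:
  fixes G :: "('a, 'b) pre_digraph" and n :: nat
  assumes "Digraph.graph G"
    and "Digraph_Component.connected G"
    and "card (verts G) = n"
    and "\<not> contains_induced G (cycle_graph 5)"
    and "\<not> contains_induced G (cycle_graph 6)"
    and "\<not> digraph_iso G (path_graph 3)"
    and "\<not> digraph_iso G (cycle_graph 3)"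
    and "\<not> digraph_iso G (cycle_graph 7)"
    and "\<not> digraph_iso G (cycle_graph 11)"
  shows "real (one_isolation_number G) \<le> real n / 4"
proof -
  interpret graph G by fact
  have con: "conn (verts G)" using connected_conn assms(2) .
  have "bad (verts G) \<or> good (verts G)"
  proof (rule bad_or_good)
    fix a b c d e
    assume E: "a \<rightarrow>\<^bsub>G\<^esub> b" "b \<rightarrow>\<^bsub>G\<^esub> c" "c \<rightarrow>\<^bsub>G\<^esub> d" "d \<rightarrow>\<^bsub>G\<^esub> e" "e \<rightarrow>\<^bsub>G\<^esub> a"
    then have "{a, b, c, d, e} \<subseteq> verts G" by (auto simp: adj_in_verts)
    then show "a \<rightarrow>\<^bsub>G\<^esub> c \<or> a \<rightarrow>\<^bsub>G\<^esub> d \<or> b \<rightarrow>\<^bsub>G\<^esub> d \<or> b \<rightarrow>\<^bsub>G\<^esub> e \<or> c \<rightarrow>\<^bsub>G\<^esub> e"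
      using induced_C5_enum[OF E] contains_induced_cycle assms(4) by blast
  next
    fix a b c d e f
    assume E: "a \<rightarrow>\<^bsub>G\<^esub> b" "b \<rightarrow>\<^bsub>G\<^esub> c" "c \<rightarrow>\<^bsub>G\<^esub> d" "d \<rightarrow>\<^bsub>G\<^esub> e" "e \<rightarrow>\<^bsub>G\<^esub> f" "f \<rightarrow>\<^bsub>G\<^esub> a"
    then have "{a, b, c, d, e, f} \<subseteq> verts G" by (auto simp: adj_in_verts)
    then show "a \<rightarrow>\<^bsub>G\<^esub> c \<or> a \<rightarrow>\<^bsub>G\<^esub> d \<or> a \<rightarrow>\<^bsub>G\<^esub> e \<or> b \<rightarrow>\<^bsub>G\<^esub> d \<or> b \<rightarrow>\<^bsub>G\<^esub> e \<or> b \<rightarrow>\<^bsub>G\<^esub> f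
        \<or> c \<rightarrow>\<^bsub>G\<^esub> e \<or> c \<rightarrow>\<^bsub>G\<^esub> f \<or> d \<rightarrow>\<^bsub>G\<^esub> f"
      using induced_C6_enum[OF E] contains_induced_cycle assms(5) by blast
  qed (use con in auto)
  moreover have "\<not> bad (verts G)"
  proof
    assume "bad (verts G)"
    then consider "card (verts G) = 3" | k h where "k = 7 \<or> k = 11" "cycle_enum h k (verts G)"
      unfolding bad_def by blast
    then show False
    proof cases
      case 1
      have "card {w\<in>verts G. u \<rightarrow>\<^bsub>G\<^esub> w} \<le> 2" if "u \<in> verts G" for u
        using bad_deg[OF \<open>bad (verts G)\<close> that] .
      \<comment> \<open>Being connected with degrees at most 2, a graph of order 3 is P3 or C3, both
        excluded by assumption.\<close>
      then have "(\<exists>h. path_enum h 3 (verts G)) \<or> (\<exists>h. cycle_enum h 3 (verts G))"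
        using deg2_enum[OF _ con] 1 by simp
      then show False using path_enum_iso[of _ 3 "verts G"] cycle_enum_iso[of _ 3 "verts G"] assms(6,7)
        unfolding induce_verts by blast
    next
      case 2
      then show False using cycle_enum_iso[of h k "verts G"] assms(8,9) unfolding induce_verts by blast
    qed
  qed
  ultimately obtain D where D: "isolating (verts G) D" "4 * card D \<le> card (verts G)"
    unfolding good_def by blast
  then have "4 * one_isolation_number G \<le> n"
    using one_isolation_number_le[OF isolating_one_isolating[OF D(1)]] assms(3) by linarith
  then show ?thesis by linarith
qed

end
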